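(* Let $M$ be a semisimple MV-algebra and $Y$ a compact Hausdorff space, and identify $\operatorname{Max}C(Y)$ with $Y$ (the point $y$ corresponding to the maximal ideal $\{a: a(y)=0\}$). Then $\operatorname{ext}\mathcal{P}(M,C(Y))\neq\emptyset$, and for every $p\in\mathcal{P}(M,C(Y))$ the following are equivalent: (1) $p\in\operatorname{ext}\mathcal{P}(M,C(Y))$; (2) $p'\in\operatorname{ext}\mathcal{P}'(M,C(Y))$; (3) $p$ is an MV-homomorphism; (4) $p'[Y]\subseteq\operatorname{ext}\operatorname{St}M$; (5) there is a unique continuous map $f\colon Y\to\operatorname{Max}M$ with $p(a)=a^{*}\circ f$ for all $a\in M$.
   Context: For an MV-algebra $(M,\oplus,\neg,0)$: $1\coloneqq\neg 0$, $a\odot b\coloneqq\neg(\neg a\oplus\neg b)$, $a\vee b\coloneqq\neg(\neg a\oplus b)\oplus b$, $a\wedge b\coloneqq\neg(\neg a\vee\neg b)$. A probability map is a function $p\colon M\to N$ between MV-algebras such that for all $a,b\in M$: (P1) $p(a\oplus b)=p(a)\oplus p(b\wedge\neg a)$; (P2) $p(\neg a)=\neg p(a)$; (P3) $p(1)=1$. $C(Y)$ is the MV-algebra of continuous functions $Y\to[0,1]$ with pointwise operations $\min(a+b,1)$, $1-a$; $\mathcal{P}(M,C(Y))$ is the set of probability maps $M\to C(Y)$, a convex subset of the linear space of maps $M\to C_{\mathbb{R}}(Y)$. A state of $M$ is a map $s\colon M\to[0,1]$ with $s(1)=1$ and $s(a\oplus b)=s(a)+s(b)$ whenever $a\odot b=0$;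 $\operatorname{St}M$ is the compact convex set of states (pointwise convergence topology, subset of $\mathbb{R}^M$), and $\operatorname{ext}$ denotes the set of extreme points of a convex set. $\operatorname{Max}M$ is the compact Hausdorff space of maximal ideals of $M$; $a^*(\mathfrak{m})\coloneqq h_{\mathfrak{m}}(a/\mathfrak{m})$, where $h_{\mathfrak{m}}$ is the unique MV-isomorphism of $M/\mathfrak{m}$ onto a subalgebra of $[0,1]$. $M$ is semisimple if the intersection of its maximal ideals is $\{0\}$. For $p\in\mathcal{P}(M,C(Y))$ the dual $p'\colon Y\to\operatorname{St}M$ is $p'(y)(a)\coloneqq p(a)(y)$. $\mathcal{P}'(M,C(Y))=\{p': p\in\mathcal{P}(M,C(Y))\}$, which equals the set of all continuous maps $Y\to\operatorname{St}M$ and is a convex subset of the linear space $\mathbb{R}^{M\times Y}$ (pointwise convex combinations). *)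

theory Defs
  imports "HOL-Analysis.Analysis"
begin

record 'a mv =
  mv_car  :: "'a set"
  mv_add  :: "'a \<Rightarrow> 'a \<Rightarrow> 'a"
  mv_neg  :: "'a \<Rightarrow> 'a"
  mv_zero :: "'a"

definition mv_one :: "'a mv \<Rightarrow> 'a" where
  "mv_one M = mv_neg M (mv_zero M)"

definition mv_mult :: "'a mv \<Rightarrow> 'a \<Rightarrow> 'a \<Rightarrow> 'a" where
  "mv_mult M a b = mv_neg M (mv_add M (mv_neg M a) (mv_neg M b))"

definition mv_sup :: "'a mv \<Rightarrow> 'a \<Rightarrow> 'a \<Rightarrow> 'a" where
  "mv_sup M a b = mv_add M (mv_neg M (mv_add M (mv_neg M a) b)) b"

definition mv_inf :: "'a mv \<Rightarrow> 'a \<Rightarrow> 'a \<Rightarrow> 'a" where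
  "mv_inf M a b = mv_neg M (mv_sup M (mv_neg M a) (mv_neg M b))"

definition mv_le :: "'a mv \<Rightarrow> 'a \<Rightarrow> 'a \<Rightarrow> bool" where
  "mv_le M a b \<longleftrightarrow> mv_add M (mv_neg M a) b = mv_one M"

definition mv_algebra :: "'a mv \<Rightarrow> bool" where
  "mv_algebra M \<longleftrightarrow>
     mv_zero M \<in> mv_car M \<and>
     (\<forall>a\<in>mv_car M. \<forall>b\<in>mv_car M. mv_add M a b \<in> mv_car M) \<and>
     (\<forall>a\<in>mv_car M. mv_neg M a \<in> mv_car M) \<and>
     (\<forall>a\<in>mv_car M. \<forall>b\<in>mv_car M. \<forall>c\<in>mv_car M.
        mv_add M a (mv_add M b c) = mv_add M (mv_add M a b) c) \<and>
     (\<forall>a\<in>mv_car M. \<forall>b\<in>mv_car M. mv_add M a b = mv_add M b a) \<and>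
     (\<forall>a\<in>mv_car M. mv_add M a (mv_zero M) = a) \<and>
     (\<forall>a\<in>mv_car M. mv_neg M (mv_neg M a) = a) \<and>
     (\<forall>a\<in>mv_car M. mv_add M a (mv_one M) = mv_one M) \<and>
     (\<forall>a\<in>mv_car M. \<forall>b\<in>mv_car M.
        mv_add M (mv_neg M (mv_add M (mv_neg M a) b)) b =
        mv_add M (mv_neg M (mv_add M (mv_neg M b) a)) a)"

definition unit_mv :: "real mv" where
  "unit_mv = \<lparr> mv_car = {0..1}, mv_add = (\<lambda>x y. min (x + y) 1),
               mv_neg = (\<lambda>x. 1 - x), mv_zero = 0 \<rparr>"

definition CY :: "('y::topological_space \<Rightarrow> real) mv" where
  "CY = \<lparr> mv_car = {f. continuous_on UNIV f \<and> (\<forall>y. f y \<in> {0..1})},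
          mv_add = (\<lambda>f g y. min (f y + g y) 1),
          mv_neg = (\<lambda>f y. 1 - f y), mv_zero = (\<lambda>y. 0) \<rparr>"

definition mv_hom :: "'a mv \<Rightarrow> 'b mv \<Rightarrow> ('a \<Rightarrow> 'b) \<Rightarrow> bool" where
  "mv_hom M N h \<longleftrightarrow>
     (\<forall>a\<in>mv_car M. h a \<in> mv_car N) \<and>
     (\<forall>a\<in>mv_car M. \<forall>b\<in>mv_car M. h (mv_add M a b) = mv_add N (h a) (h b)) \<and>
     (\<forall>a\<in>mv_car M. h (mv_neg M a) = mv_neg N (h a)) \<and>
     h (mv_zero M) = mv_zero N"

definition mv_ideal :: "'a mv \<Rightarrow> 'a set \<Rightarrow> bool" where
  "mv_ideal M I \<longleftrightarrow> I \<subseteq> mv_car M \<and> mv_zero M \<in> I \<and>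
     (\<forall>a\<in>I. \<forall>b\<in>mv_car M. mv_le M b a \<longrightarrow> b \<in> I) \<and>
     (\<forall>a\<in>I. \<forall>b\<in>I. mv_add M a b \<in> I)"

definition mv_max_ideals :: "'a mv \<Rightarrow> 'a set set" where
  "mv_max_ideals M = {m. mv_ideal M m \<and> m \<noteq> mv_car M \<and>
     (\<forall>J. mv_ideal M J \<and> m \<subseteq> J \<longrightarrow> J = m \<or> J = mv_car M)}"

definition mv_semisimple :: "'a mv \<Rightarrow> bool" where
  "mv_semisimple M \<longleftrightarrow> mv_car M \<inter> \<Inter> (mv_max_ideals M) = {mv_zero M}"

text \<open>Hull-kernel topology on Max M: open sets are {m. I not contained in m};
  generated by the sets {m. a \<notin> m}, a \<in> M.\<close>
definition max_topology :: "'a mv \<Rightarrow> 'a set topology" where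
  "max_topology M = topology_generated_by
     {{m \<in> mv_max_ideals M. a \<notin> m} | a. a \<in> mv_car M}"

definition mv_dist :: "'a mv \<Rightarrow> 'a \<Rightarrow> 'a \<Rightarrow> 'a" where
  "mv_dist M a b = mv_add M (mv_mult M a (mv_neg M b)) (mv_mult M b (mv_neg M a))"

definition mv_class :: "'a mv \<Rightarrow> 'a set \<Rightarrow> 'a \<Rightarrow> 'a set" where
  "mv_class M I a = {b \<in> mv_car M. mv_dist M a b \<in> I}"

definition mv_quot :: "'a mv \<Rightarrow> 'a set \<Rightarrow> 'a set mv" where
  "mv_quot M I = \<lparr> mv_car = mv_class M I ` mv_car M,
     mv_add = (\<lambda>X Y. mv_class M I (mv_add M (SOME x. x \<in> X) (SOME y. y \<in> Y))),
     mv_neg = (\<lambda>X. mv_class M I (mv_neg M (SOME x. x \<in> X))),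
     mv_zero = mv_class M I (mv_zero M) \<rparr>"

text \<open>a*(m) = h_m(a/m), h_m the unique MV-isomorphism of M/m onto a subalgebra of [0,1].\<close>
definition astar :: "'a mv \<Rightarrow> 'a \<Rightarrow> 'a set \<Rightarrow> real" where
  "astar M a m = (THE r. \<exists>h. mv_hom (mv_quot M m) unit_mv h \<and>
       inj_on h (mv_car (mv_quot M m)) \<and> h (mv_class M m a) = r)"

definition prob_map :: "'a mv \<Rightarrow> 'b mv \<Rightarrow> ('a \<Rightarrow> 'b) \<Rightarrow> bool" where
  "prob_map M N p \<longleftrightarrow>
     (\<forall>a\<in>mv_car M. p a \<in> mv_car N) \<and>
     (\<forall>a\<in>mv_car M. \<forall>b\<in>mv_car M.
        p (mv_add M a b) = mv_add N (p a) (p (mv_inf M b (mv_neg M a)))) \<and>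
     (\<forall>a\<in>mv_car M. p (mv_neg M a) = mv_neg N (p a)) \<and>
     p (mv_one M) = mv_one N"

text \<open>P(M,C(Y)): probability maps M \<rightarrow> C(Y), as maps on the carrier of M
  (extended by 0 outside the carrier, so that they live in the linear space
  of maps M \<rightarrow> C_R(Y)).\<close>
definition PMC :: "'a mv \<Rightarrow> ('a \<Rightarrow> 'y::topological_space \<Rightarrow> real) set" where
  "PMC M = {p. prob_map M CY p \<and> (\<forall>a. a \<notin> mv_car M \<longrightarrow> p a = (\<lambda>y. 0))}"

definition dual :: "('a \<Rightarrow> 'y \<Rightarrow> real) \<Rightarrow> 'y \<Rightarrow> 'a \<Rightarrow> real" where
  "dual p = (\<lambda>y a. p a y)"

definition PMC' :: "'a mv \<Rightarrow> ('y::topological_space \<Rightarrow> 'a \<Rightarrow> real) set" where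
  "PMC' M = dual ` PMC M"

definition is_state :: "'a mv \<Rightarrow> ('a \<Rightarrow> real) \<Rightarrow> bool" where
  "is_state M s \<longleftrightarrow>
     (\<forall>a\<in>mv_car M. s a \<in> {0..1}) \<and> s (mv_one M) = 1 \<and>
     (\<forall>a\<in>mv_car M. \<forall>b\<in>mv_car M. mv_mult M a b = mv_zero M \<longrightarrow>
        s (mv_add M a b) = s a + s b)"

text \<open>St M as a subset of R^M (functions vanishing off the carrier).\<close>
definition states :: "'a mv \<Rightarrow> ('a \<Rightarrow> real) set" where
  "states M = {s. is_state M s \<and> (\<forall>a. a \<notin> mv_car M \<longrightarrow> s a = 0)}"

definition ext1 :: "('x \<Rightarrow> real) set \<Rightarrow> ('x \<Rightarrow> real) set" where
  "ext1 S = {x \<in> S. \<forall>u\<in>S. \<forall>v\<in>S. \<forall>t::real. 0 < t \<and> t < 1 \<and>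
      x = (\<lambda>i. t * u i + (1 - t) * v i) \<longrightarrow> u = v}"

definition ext2 :: "('x \<Rightarrow> 'z \<Rightarrow> real) set \<Rightarrow> ('x \<Rightarrow> 'z \<Rightarrow> real) set" where
  "ext2 S = {x \<in> S. \<forall>u\<in>S. \<forall>v\<in>S. \<forall>t::real. 0 < t \<and> t < 1 \<and>
      x = (\<lambda>i j. t * u i j + (1 - t) * v i j) \<longrightarrow> u = v}"

end

theory Submission
  imports Defs
begin

text \<open>
  Write \<open>s\<close> for a state \<open>a \<mapsto> p a y\<close>. A state is a homomorphism as soon as \<open>c \<sqinter> d = 0\<close> forces
  \<open>s c = 0\<close> or \<open>s d = 0\<close>, and a homomorphism \<open>s\<close> is the only state vanishing on its kernel; hence
  homomorphisms into \<open>[0,1]\<close> are extreme states, and a map all of whose states are extreme is extreme.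

  Conversely let \<open>p\<close> be extreme. Following Ellis and Phelps one perturbs \<open>p\<close> by
  \<open>g \<mapsto> \<integral> x g - p x p g\<close>. As \<open>M\<close> has no product, the integral is the limit of averages of states of
  terms \<open>x' \<sqinter> g\<close>, where \<open>x'\<close> runs over the \<open>n\<close>-fold iterates of \<open>x\<close> under \<open>x \<oplus> x\<close> and \<open>x \<odot> x\<close>. The
  error is at most \<open>2 ^ - n\<close> uniformly in \<open>y\<close>, so continuity in \<open>y\<close> survives. Extremality gives
  \<open>\<integral> x g = p x p g\<close>, which vanishes for \<open>x \<sqinter> g = 0\<close>, and \<open>p\<close> is a homomorphism.

  The same averaging of 0--1 valued functions, applied in the chain \<open>M / m\<close>, produces the state of
  Hoelder's theorem, which makes \<open>a\<^sup>*(m)\<close> well defined for every maximal ideal \<open>m\<close>.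
\<close>

text \<open>States are fixed by this averaging operator, because \<open>x \<oplus> x\<close> and
  \<open>x \<odot> x\<close> are the parts of \<open>2 x\<close> below and above 1. Its
  \<open>n\<close>-th power averages a function over the \<open>2 ^ n\<close> iterates of
  \<open>x\<close>.\<close>

definition bisect :: "'a mv \<Rightarrow> ('a \<Rightarrow> real) \<Rightarrow> 'a \<Rightarrow> real" where
  "bisect M F = (\<lambda>x. (F (mv_add M x x) + F (mv_mult M x x)) / 2)"

lemma bisect_funpow_Suc:
  "(bisect M ^^ Suc n) F x = ((bisect M ^^ n) F (mv_add M x x) + (bisect M ^^ n) F (mv_mult M x x)) / 2"
  by (simp add: bisect_def)

section \<open>Arithmetic and order of MV-algebras\<close>

locale mv_alg =
  fixes M :: "'a mv"
  assumes alg: "mv_algebra M"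
begin

abbreviation add (infixl "\<oplus>" 65) where "a \<oplus> b \<equiv> mv_add M a b"
abbreviation mult (infixl "\<odot>" 70) where "a \<odot> b \<equiv> mv_mult M a b"
abbreviation neg ("\<sim>_" [81] 80) where "\<sim>a \<equiv> mv_neg M a"
abbreviation meet (infixl "\<sqinter>" 70) where "a \<sqinter> b \<equiv> mv_inf M a b"
abbreviation le (infix "\<preceq>" 50) where "a \<preceq> b \<equiv> mv_le M a b"
abbreviation zero ("\<zero>") where "\<zero> \<equiv> mv_zero M"
abbreviation one ("\<one>") where "\<one> \<equiv> mv_one M"
abbreviation car where "car \<equiv> mv_car M"

lemma zero_closed [simp]: "\<zero> \<in> car"
  and add_closed [simp]: "\<lbrakk>a \<in> car; b \<in> car\<rbrakk> \<Longrightarrow> a \<oplus> b \<in> car"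
  and neg_closed [simp]: "a \<in> car \<Longrightarrow> \<sim>a \<in> car"
  and add_assoc: "\<lbrakk>a \<in> car; b \<in> car; c \<in> car\<rbrakk> \<Longrightarrow> (a \<oplus> b) \<oplus> c = a \<oplus> (b \<oplus> c)"
  and add_commute: "\<lbrakk>a \<in> car; b \<in> car\<rbrakk> \<Longrightarrow> a \<oplus> b = b \<oplus> a"
  and add_zero [simp]: "a \<in> car \<Longrightarrow> a \<oplus> \<zero> = a"
  and neg_neg [simp]: "a \<in> car \<Longrightarrow> \<sim>(\<sim>a) = a"
  and add_one [simp]: "a \<in> car \<Longrightarrow> a \<oplus> \<one> = \<one>"
  and lukasiewicz: "\<lbrakk>a \<in> car; b \<in> car\<rbrakk> \<Longrightarrow> \<sim>(\<sim>a \<oplus> b) \<oplus> b = \<sim>(\<sim>b \<oplus> a) \<oplus> a"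
  using alg unfolding mv_algebra_def by metis+

lemma neg_zero [simp]: "\<sim>\<zero> = \<one>"
  by (simp add: mv_one_def)

lemma one_closed [simp]: "\<one> \<in> car"
  by (metis neg_zero neg_closed zero_closed)

lemma neg_one [simp]: "\<sim>\<one> = \<zero>"
  by (metis neg_zero neg_neg zero_closed)

lemma mult_closed [simp]: "\<lbrakk>a \<in> car; b \<in> car\<rbrakk> \<Longrightarrow> a \<odot> b \<in> car"
  and meet_closed [simp]: "\<lbrakk>a \<in> car; b \<in> car\<rbrakk> \<Longrightarrow> a \<sqinter> b \<in> car"
  by (simp_all add: mv_mult_def mv_inf_def mv_sup_def)

lemma zero_add [simp]: "a \<in> car \<Longrightarrow> \<zero> \<oplus> a = a"
  and one_add [simp]: "a \<in> car \<Longrightarrow> \<one> \<oplus> a = \<one>"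
  by (simp_all add: add_commute[of _ a])

lemma add_left_commute: "\<lbrakk>a \<in> car; b \<in> car; c \<in> car\<rbrakk> \<Longrightarrow> a \<oplus> (b \<oplus> c) = b \<oplus> (a \<oplus> c)"
  by (metis add_assoc add_commute)

lemma neg_mult [simp]: "\<lbrakk>a \<in> car; b \<in> car\<rbrakk> \<Longrightarrow> \<sim>(a \<odot> b) = \<sim>a \<oplus> \<sim>b"
  by (simp add: mv_mult_def)

lemma neg_add [simp]: "\<lbrakk>a \<in> car; b \<in> car\<rbrakk> \<Longrightarrow> \<sim>(a \<oplus> b) = \<sim>a \<odot> \<sim>b"
  by (simp add: mv_mult_def)

lemma neg_eq_iff: "\<lbrakk>a \<in> car; b \<in> car\<rbrakk> \<Longrightarrow> \<sim>a = \<sim>b \<longleftrightarrow> a = b"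
  by (metis neg_neg)

lemma mult_commute: "\<lbrakk>a \<in> car; b \<in> car\<rbrakk> \<Longrightarrow> a \<odot> b = b \<odot> a"
  by (simp add: mv_mult_def add_commute del: neg_add)

lemma mult_assoc: "\<lbrakk>a \<in> car; b \<in> car; c \<in> car\<rbrakk> \<Longrightarrow> (a \<odot> b) \<odot> c = a \<odot> (b \<odot> c)"
  by (simp add: mv_mult_def add_assoc del: neg_add)

lemma mult_one [simp]: "a \<in> car \<Longrightarrow> a \<odot> \<one> = a"
  and one_mult [simp]: "a \<in> car \<Longrightarrow> \<one> \<odot> a = a"
  and mult_zero [simp]: "a \<in> car \<Longrightarrow> a \<odot> \<zero> = \<zero>"
  and zero_mult [simp]: "a \<in> car \<Longrightarrow> \<zero> \<odot> a = \<zero>"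
  by (simp_all add: mv_mult_def del: neg_add)

lemma neg_add_self [simp]: "a \<in> car \<Longrightarrow> \<sim>a \<oplus> a = \<one>"
  using lukasiewicz[of a \<one>] by simp

lemma add_neg_self [simp]: "a \<in> car \<Longrightarrow> a \<oplus> \<sim>a = \<one>"
  by (simp add: add_commute[of a "\<sim>a"])

lemma mult_neg_self [simp]: "a \<in> car \<Longrightarrow> a \<odot> \<sim>a = \<zero>"
  and neg_mult_self [simp]: "a \<in> car \<Longrightarrow> \<sim>a \<odot> a = \<zero>"
  by (simp_all add: mv_mult_def del: neg_add)

lemma le_refl [simp]: "a \<in> car \<Longrightarrow> a \<preceq> a"
  and zero_le [simp]: "a \<in> car \<Longrightarrow> \<zero> \<preceq> a"
  and le_one [simp]: "a \<in> car \<Longrightarrow> a \<preceq> \<one>"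
  by (simp_all add: mv_le_def)

lemma le_antisym: "\<lbrakk>a \<preceq> b; b \<preceq> a; a \<in> car; b \<in> car\<rbrakk> \<Longrightarrow> a = b"
  using lukasiewicz[of a b] by (simp add: mv_le_def del: neg_add)

text \<open>The Lukasiewicz axiom makes the order algebraic: the truncated difference
  \<open>b \<odot> \<sim>a\<close> is the summand that lifts \<open>a\<close> to
  \<open>b\<close>.\<close>

lemma le_diff_add: "\<lbrakk>a \<preceq> b; a \<in> car; b \<in> car\<rbrakk> \<Longrightarrow> a \<oplus> (b \<odot> \<sim>a) = b"
  using lukasiewicz[of a b] by (simp add: mv_le_def add_commute[of a] mv_mult_def del: neg_add)

lemma le_add [simp]: "\<lbrakk>a \<in> car; b \<in> car\<rbrakk> \<Longrightarrow> a \<preceq> a \<oplus> b"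
  by (simp add: mv_le_def flip: add_assoc)

lemma le_add2 [simp]: "\<lbrakk>a \<in> car; b \<in> car\<rbrakk> \<Longrightarrow> a \<preceq> b \<oplus> a"
  by (simp add: add_commute)

lemma le_trans: "\<lbrakk>a \<preceq> b; b \<preceq> c; a \<in> car; b \<in> car; c \<in> car\<rbrakk> \<Longrightarrow> a \<preceq> c"
  by (metis add_assoc add_closed le_add le_diff_add mult_closed neg_closed)

lemma neg_le_iff: "\<lbrakk>a \<in> car; b \<in> car\<rbrakk> \<Longrightarrow> \<sim>a \<preceq> \<sim>b \<longleftrightarrow> b \<preceq> a"
  by (simp add: mv_le_def add_commute)

lemma le_neg_commute: "\<lbrakk>a \<in> car; b \<in> car\<rbrakk> \<Longrightarrow> a \<preceq> \<sim>b \<longleftrightarrow> b \<preceq> \<sim>a"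
  by (simp add: mv_le_def add_commute)

lemma add_mono_right: "\<lbrakk>b \<preceq> c; a \<in> car; b \<in> car; c \<in> car\<rbrakk> \<Longrightarrow> a \<oplus> b \<preceq> a \<oplus> c"
  by (metis add_assoc add_closed le_add le_diff_add mult_closed neg_closed)

lemma add_mono:
  assumes "a \<preceq> b" "c \<preceq> d" and [simp]: "a \<in> car" "b \<in> car" "c \<in> car" "d \<in> car"
  shows "a \<oplus> c \<preceq> b \<oplus> d"
proof (rule le_trans)
  show "a \<oplus> c \<preceq> b \<oplus> c"
    using assms(1) by (simp add: add_mono_right add_commute[of a c] add_commute[of b c])
  show "b \<oplus> c \<preceq> b \<oplus> d"
    using assms(2) by (simp add: add_mono_right)
qed simp_all

lemma mult_mono: "\<lbrakk>a \<preceq> b; c \<preceq> d; a \<in> car; b \<in> car; c \<in> car; d \<in> car\<rbrakk> \<Longrightarrow> a \<odot> c \<preceq> b \<odot> d"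
  by (simp add: mv_mult_def neg_le_iff add_mono del: neg_add)

lemma mult_le1 [simp]: "\<lbrakk>a \<in> car; b \<in> car\<rbrakk> \<Longrightarrow> a \<odot> b \<preceq> a"
  using mult_mono[of a a b \<one>] by simp

lemma mult_le2 [simp]: "\<lbrakk>a \<in> car; b \<in> car\<rbrakk> \<Longrightarrow> a \<odot> b \<preceq> b"
  using mult_mono[of a \<one> b b] by simp

text \<open>Both sides unfold to the same equation up to associativity. This is the adjunction
  between subtracting \<open>b\<close> and adding \<open>b\<close>.\<close>

lemma residuation: "\<lbrakk>a \<in> car; b \<in> car; c \<in> car\<rbrakk> \<Longrightarrow> a \<odot> \<sim>b \<preceq> c \<longleftrightarrow> a \<preceq> b \<oplus> c"
  by (simp add: mv_le_def add_assoc)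

lemma le_zero_iff: "a \<in> car \<Longrightarrow> a \<preceq> \<zero> \<longleftrightarrow> a = \<zero>"
  using le_antisym by auto

lemma mult_eq_zero_iff: "\<lbrakk>a \<in> car; b \<in> car\<rbrakk> \<Longrightarrow> a \<odot> b = \<zero> \<longleftrightarrow> a \<preceq> \<sim>b"
  using residuation[of a "\<sim>b" \<zero>] by (simp add: le_zero_iff)

lemma add_eq_one_iff: "\<lbrakk>a \<in> car; b \<in> car\<rbrakk> \<Longrightarrow> a \<oplus> b = \<one> \<longleftrightarrow> \<sim>a \<preceq> b"
  by (simp add: mv_le_def)

lemma add_diff_cancel: "\<lbrakk>a \<odot> b = \<zero>; a \<in> car; b \<in> car\<rbrakk> \<Longrightarrow> (a \<oplus> b) \<odot> \<sim>b = a"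
proof -
  assume a: "a \<odot> b = \<zero>" "a \<in> car" "b \<in> car"
  have "b \<preceq> \<sim>a" using a by (simp add: mult_eq_zero_iff le_neg_commute)
  then have "b \<oplus> (\<sim>a \<odot> \<sim>b) = \<sim>a" using a by (simp add: le_diff_add)
  then have "\<sim>(b \<oplus> \<sim>(a \<oplus> b)) = a" using a by simp
  then show ?thesis using a by (simp add: mv_mult_def add_commute[of b] del: neg_mult neg_add)
qed

lemma meet_le1 [simp]: "\<lbrakk>a \<in> car; b \<in> car\<rbrakk> \<Longrightarrow> a \<sqinter> b \<preceq> a"
  and meet_le2 [simp]: "\<lbrakk>a \<in> car; b \<in> car\<rbrakk> \<Longrightarrow> a \<sqinter> b \<preceq> b"
  and meet_commute: "\<lbrakk>a \<in> car; b \<in> car\<rbrakk> \<Longrightarrow> a \<sqinter> b = b \<sqinter> a"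
proof -
  have *: "a \<sqinter> b \<preceq> b" if "a \<in> car" "b \<in> car" for a b
    using neg_le_iff[of "\<sim>(a \<sqinter> b)" "\<sim>b"] that
    by (simp add: mv_inf_def mv_sup_def del: neg_add)
  show "a \<sqinter> b = b \<sqinter> a" if "a \<in> car" "b \<in> car" for a b
    using that lukasiewicz[of "\<sim>a" "\<sim>b"] by (simp add: mv_inf_def mv_sup_def del: neg_add)
  with * show "\<lbrakk>a \<in> car; b \<in> car\<rbrakk> \<Longrightarrow> a \<sqinter> b \<preceq> a"
    "\<lbrakk>a \<in> car; b \<in> car\<rbrakk> \<Longrightarrow> a \<sqinter> b \<preceq> b"
    using *[of b a] *[of a b] by simp_all
qed

text \<open>Dually this concerns the join \<open>\<sim>b \<oplus> (\<sim>a \<odot> b)\<close> of the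
  negations: it is monotone in \<open>\<sim>a\<close>, and putting the upper bound
  \<open>\<sim>c\<close> for \<open>\<sim>a\<close> collapses it to \<open>\<sim>c\<close>.\<close>

lemma le_meet: "\<lbrakk>c \<preceq> a; c \<preceq> b; a \<in> car; b \<in> car; c \<in> car\<rbrakk> \<Longrightarrow> c \<preceq> a \<sqinter> b"
proof -
  assume a: "c \<preceq> a" "c \<preceq> b" and [simp]: "a \<in> car" "b \<in> car" "c \<in> car"
  have "\<sim>b \<oplus> (\<sim>a \<odot> b) \<preceq> \<sim>b \<oplus> (\<sim>c \<odot> b)"
    using a by (intro add_mono mult_mono) (auto simp: neg_le_iff)
  also have "\<sim>b \<oplus> (\<sim>c \<odot> b) = \<sim>c"
    using le_diff_add[of "\<sim>b" "\<sim>c"] a by (simp add: neg_le_iff)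
  finally have "\<sim>(a \<sqinter> b) \<preceq> \<sim>c"
    by (simp add: mv_inf_def mv_sup_def mv_mult_def add_commute del: neg_add)
  then show ?thesis by (simp add: neg_le_iff)
qed

lemma meet_mono: "\<lbrakk>a \<preceq> b; c \<preceq> d; a \<in> car; b \<in> car; c \<in> car; d \<in> car\<rbrakk> \<Longrightarrow> a \<sqinter> c \<preceq> b \<sqinter> d"
  by (meson le_meet le_trans meet_closed meet_le1 meet_le2)

lemma meet_absorb: "\<lbrakk>a \<preceq> b; a \<in> car; b \<in> car\<rbrakk> \<Longrightarrow> a \<sqinter> b = a"
  by (intro le_antisym le_meet) auto

lemma meet_zero [simp]: "a \<in> car \<Longrightarrow> a \<sqinter> \<zero> = \<zero>" "a \<in> car \<Longrightarrow> \<zero> \<sqinter> a = \<zero>"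
  and meet_one [simp]: "a \<in> car \<Longrightarrow> a \<sqinter> \<one> = a" "a \<in> car \<Longrightarrow> \<one> \<sqinter> a = a"
  by (simp_all add: meet_absorb meet_commute[of a \<zero>] meet_commute[of \<one> a])

text \<open>By \<open>residuation\<close>, adding \<open>a\<close> is a right adjoint and so
  preserves meets. The arbitrary lower bound \<open>t\<close> avoids expanding meets later.\<close>

lemma add_meet_glb:
  "\<lbrakk>t \<preceq> a \<oplus> b; t \<preceq> a \<oplus> c; a \<in> car; b \<in> car; c \<in> car; t \<in> car\<rbrakk> \<Longrightarrow> t \<preceq> a \<oplus> (b \<sqinter> c)"
  by (simp add: le_meet flip: residuation)

section \<open>Truncated differences and disjoint elements\<close>

lemma diff_meet:
  assumes [simp]: "a \<in> car" "b \<in> car"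
  shows "a \<odot> \<sim>(a \<sqinter> b) = a \<odot> \<sim>b"
proof (rule le_antisym)
  have "a \<preceq> (a \<odot> \<sim>b) \<oplus> b" using residuation[of a b "a \<odot> \<sim>b"] by (simp add: add_commute)
  then have "a \<preceq> (a \<odot> \<sim>b) \<oplus> (a \<sqinter> b)" by (intro add_meet_glb) simp_all
  then show "a \<odot> \<sim>(a \<sqinter> b) \<preceq> a \<odot> \<sim>b"
    by (simp add: residuation add_commute[of "a \<sqinter> b"])
  show "a \<odot> \<sim>b \<preceq> a \<odot> \<sim>(a \<sqinter> b)" by (intro mult_mono) (simp_all add: neg_le_iff)
qed simp_all

text \<open>Both differences may be taken over \<open>d = a \<sqinter> b\<close>. An
  \<open>e\<close> below both satisfies \<open>d \<oplus> e \<preceq> d\<close>, and cancelling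
  \<open>d\<close> leaves \<open>\<zero>\<close>. This prelinearity is the source of the disjoint
  pairs used later.\<close>

lemma meet_diff_disjoint:
  assumes [simp]: "a \<in> car" "b \<in> car"
  shows "(a \<odot> \<sim>b) \<sqinter> (b \<odot> \<sim>a) = \<zero>"
proof -
  define d e where "d = a \<sqinter> b" and "e = (a \<odot> \<sim>b) \<sqinter> (b \<odot> \<sim>a)"
  have [simp]: "d \<in> car" "e \<in> car" by (simp_all add: d_def e_def)
  have 1: "e \<preceq> a \<odot> \<sim>d" "e \<preceq> b \<odot> \<sim>d"
    using diff_meet[of a b] diff_meet[of b a] by (simp_all add: d_def e_def meet_commute[of b])
  have "d \<oplus> e \<preceq> d \<oplus> (a \<odot> \<sim>d)" "d \<oplus> e \<preceq> d \<oplus> (b \<odot> \<sim>d)"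
    using 1 by (auto intro: add_mono_right)
  then have "d \<oplus> e \<preceq> a" "d \<oplus> e \<preceq> b"
    by (simp_all add: le_diff_add d_def)
  then have "d \<oplus> e \<preceq> d" by (subst (2) d_def, intro le_meet) auto
  moreover have "e \<preceq> \<sim>d" using 1 le_trans[of e "a \<odot> \<sim>d" "\<sim>d"] by simp
  then have "e = (e \<oplus> d) \<odot> \<sim>d" by (simp add: add_diff_cancel mult_eq_zero_iff)
  ultimately have "e \<preceq> d \<odot> \<sim>d"
    by (metis \<open>d \<in> car\<close> \<open>e \<in> car\<close> add_closed add_commute le_refl mult_mono neg_closed)
  then show ?thesis by (simp add: le_zero_iff flip: e_def)
qed

text \<open>The right side is the meet of four sums, each above the left side. Hence the elements
  disjoint from \<open>x\<close> are closed under addition.\<close>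

lemma meet_add_le:
  assumes [simp]: "x \<in> car" "y \<in> car" "z \<in> car"
  shows "x \<sqinter> (y \<oplus> z) \<preceq> (x \<sqinter> y) \<oplus> (x \<sqinter> z)"
proof -
  let ?w = "x \<sqinter> (y \<oplus> z)"
  have 1: "?w \<preceq> x \<oplus> t" "?w \<preceq> t \<oplus> x" if "t \<in> car" for t
    using that le_trans[of ?w x "x \<oplus> t"] le_trans[of ?w x "t \<oplus> x"] by simp_all
  have "?w \<preceq> t \<oplus> (x \<sqinter> z)" if "?w \<preceq> t \<oplus> z" "t \<in> car" for t
    using that 1 by (intro add_meet_glb) simp_all
  then have "?w \<preceq> (x \<sqinter> z) \<oplus> x" "?w \<preceq> (x \<sqinter> z) \<oplus> y"
    using 1 by (simp_all add: add_commute[of "x \<sqinter> z"])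
  then show ?thesis
    using add_meet_glb[of ?w "x \<sqinter> z" x y] by (simp add: add_commute[of _ "x \<sqinter> z"])
qed

lemma disjoint_add:
  assumes "x \<sqinter> y = \<zero>" "x \<sqinter> z = \<zero>" and [simp]: "x \<in> car" "y \<in> car" "z \<in> car"
  shows "x \<sqinter> (y \<oplus> z) = \<zero>"
  using meet_add_le[of x y z] assms by (simp add: le_zero_iff)

lemma disjoint_mono:
  assumes "a \<preceq> b" "c \<preceq> d" "b \<sqinter> d = \<zero>" and [simp]: "a \<in> car" "b \<in> car" "c \<in> car" "d \<in> car"
  shows "a \<sqinter> c = \<zero>"
  using meet_mono[of a b c d] assms by (simp add: le_zero_iff)

lemma disjoint_imp_mult_zero:
  assumes "c \<sqinter> d = \<zero>" and [simp]: "c \<in> car" "d \<in> car"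
  shows "c \<odot> d = \<zero>"
  using le_meet[of "c \<odot> d" c d] assms by (simp add: le_zero_iff)

text \<open>The excess of \<open>a + b\<close> over 1 and its shortfall below 1 are
  disjoint.\<close>

lemma disjoint_mult: "\<lbrakk>a \<in> car; b \<in> car\<rbrakk> \<Longrightarrow> (a \<odot> b) \<sqinter> (\<sim>a \<odot> \<sim>b) = \<zero>"
  using meet_diff_disjoint[of a "\<sim>b"] by (simp add: mult_commute)

lemma mult_add_le:
  assumes [simp]: "a \<in> car" "b \<in> car" "c \<in> car"
  shows "a \<odot> (b \<oplus> c) \<preceq> (a \<odot> b) \<oplus> c"
proof -
  have "b \<preceq> \<sim>a \<oplus> (a \<odot> b)"
    using residuation[of b "\<sim>a" "a \<odot> b"] by (simp add: mult_commute)
  then have "b \<oplus> c \<preceq> \<sim>a \<oplus> ((a \<odot> b) \<oplus> c)"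
    by (simp add: add_mono flip: add_assoc)
  then show ?thesis
    using residuation[of "b \<oplus> c" "\<sim>a" "(a \<odot> b) \<oplus> c"] by (simp add: mult_commute)
qed

text \<open>Multiplication by \<open>a\<close> is a left adjoint, so meets need another argument:
  the estimate holds up to the error \<open>b \<odot> \<sim>c\<close> and also up to
  \<open>c \<odot> \<sim>b\<close>, and these two errors are disjoint.\<close>

lemma mult_meet_glb:
  assumes "t \<preceq> a \<odot> b" "t \<preceq> a \<odot> c" and [simp]: "a \<in> car" "b \<in> car" "c \<in> car" "t \<in> car"
  shows "t \<preceq> a \<odot> (b \<sqinter> c)"
proof -
  let ?w = "a \<odot> (b \<sqinter> c)"
  \<comment> \<open>Rebinding \<open>b\<close> and \<open>c\<close> while \<open>?w\<close> stays
    fixed lets the estimate serve both orders of the pair.\<close>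
  have *: "t \<preceq> ?w \<oplus> (b \<odot> \<sim>c)" if "t \<preceq> a \<odot> b" and [simp]: "b \<in> car" "c \<in> car"
    and w: "?w = a \<odot> (b \<sqinter> c)" for b c w
  proof -
    have "b = (b \<sqinter> c) \<oplus> (b \<odot> \<sim>c)"
      using le_diff_add[of "b \<sqinter> c" b] by (simp add: diff_meet)
    then have "a \<odot> b \<preceq> ?w \<oplus> (b \<odot> \<sim>c)"
      using mult_add_le[of a "b \<sqinter> c" "b \<odot> \<sim>c"] w by simp
    then show ?thesis using le_trans[OF that(1)] by simp
  qed
  from *[of b c] *[of c b] assms have "t \<preceq> ?w \<oplus> ((b \<odot> \<sim>c) \<sqinter> (c \<odot> \<sim>b))"
    by (intro add_meet_glb) (simp_all add: meet_commute[of c b])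
  then show ?thesis by (simp add: meet_diff_disjoint)
qed

text \<open>In \<open>[0,1]\<close> both sides are \<open>a + b + c - 1\<close> without truncation.
  Adding \<open>\<sim>c\<close> to the right side restores \<open>a \<oplus> b\<close>, and
  multiplying by \<open>c\<close> cancels it again.\<close>

lemma add_mult_assoc:
  assumes "a \<odot> b = \<zero>" "b \<oplus> c = \<one>" and [simp]: "a \<in> car" "b \<in> car" "c \<in> car"
  shows "(a \<oplus> b) \<odot> c = a \<oplus> (b \<odot> c)"
proof -
  have "\<sim>c \<preceq> b" using assms by (simp add: add_commute[of b] add_eq_one_iff)
  then have b: "\<sim>c \<oplus> (b \<odot> c) = b" using le_diff_add[of "\<sim>c" b] by simp
  have "a \<preceq> \<sim>b" using assms by (simp add: mult_eq_zero_iff)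
  then have "b \<preceq> \<sim>a" by (simp add: le_neg_commute)
  have "a \<preceq> \<sim>(\<sim>c)"
    using \<open>\<sim>c \<preceq> b\<close> \<open>b \<preceq> \<sim>a\<close> le_trans[of "\<sim>c" b "\<sim>a"] le_neg_commute[of a "\<sim>c"] by simp
  have "b \<odot> c \<preceq> c \<odot> \<sim>a"
    using \<open>b \<preceq> \<sim>a\<close> mult_mono[of b "\<sim>a" c c] by (simp add: mult_commute[of c])
  then have "a \<oplus> (b \<odot> c) \<preceq> a \<oplus> (c \<odot> \<sim>a)" by (simp add: add_mono_right)
  then have "(a \<oplus> (b \<odot> c)) \<odot> \<sim>c = \<zero>"
    using \<open>a \<preceq> \<sim>(\<sim>c)\<close> by (simp add: le_diff_add mult_eq_zero_iff)
  then have "((a \<oplus> (b \<odot> c)) \<oplus> \<sim>c) \<odot> c = a \<oplus> (b \<odot> c)"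
    using add_diff_cancel[of "a \<oplus> (b \<odot> c)" "\<sim>c"] by simp
  moreover have "(a \<oplus> (b \<odot> c)) \<oplus> \<sim>c = a \<oplus> b"
    using b by (simp add: add_assoc add_commute[of "b \<odot> c" "\<sim>c"])
  ultimately show ?thesis by simp
qed

text \<open>In \<open>[0,1]\<close> both sides are \<open>a + b + c - 1\<close> truncated at 0. The
  identity \<open>c = \<sim>b \<odot> (c \<oplus> b)\<close> carries \<open>b\<close>
  across.\<close>

lemma mult_add_assoc:
  assumes "a \<odot> b = \<zero>" "b \<odot> c = \<zero>" and [simp]: "a \<in> car" "b \<in> car" "c \<in> car"
  shows "(a \<oplus> b) \<odot> c = a \<odot> (b \<oplus> c)"
proof -
  have "b \<preceq> \<sim>c" using assms by (simp add: mult_eq_zero_iff)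
  then have "b \<oplus> (\<sim>c \<odot> \<sim>b) = \<sim>c" by (simp add: le_diff_add)
  then have "c = \<sim>b \<odot> (c \<oplus> b)"
    by (metis assms(4,5) neg_add neg_mult neg_neg add_closed neg_closed)
  then have "(a \<oplus> b) \<odot> c = ((a \<oplus> b) \<odot> \<sim>b) \<odot> (c \<oplus> b)"
    by (simp add: mult_assoc)
  then show ?thesis using assms by (simp add: add_diff_cancel add_commute)
qed


lemma add_meet_neg: "\<lbrakk>a \<in> car; b \<in> car\<rbrakk> \<Longrightarrow> a \<oplus> (b \<sqinter> \<sim>a) = a \<oplus> b"
  by (intro le_antisym add_meet_glb) (auto intro: add_mono_right)

lemma mult_meet_neg: "\<lbrakk>a \<in> car; b \<in> car\<rbrakk> \<Longrightarrow> a \<odot> (b \<sqinter> \<sim>a) = \<zero>"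
  by (simp add: mult_eq_zero_iff le_neg_commute[of a])

text \<open>Splits \<open>b\<close> into the part that still fits on top of \<open>a\<close> and the
  overflow of \<open>a + b\<close> beyond 1.\<close>

lemma meet_neg_add_mult: "\<lbrakk>a \<in> car; b \<in> car\<rbrakk> \<Longrightarrow> (b \<sqinter> \<sim>a) \<oplus> (b \<odot> a) = b"
  using le_diff_add[of "b \<sqinter> \<sim>a" b] diff_meet[of b "\<sim>a"] by simp

lemma meet_neg_mult_mult: "\<lbrakk>a \<in> car; b \<in> car\<rbrakk> \<Longrightarrow> (b \<sqinter> \<sim>a) \<odot> (b \<odot> a) = \<zero>"
  using le_trans[of "b \<sqinter> \<sim>a" "\<sim>a" "\<sim>(b \<odot> a)"] by (simp add: mult_eq_zero_iff)

lemma mult_diff_zero: "\<lbrakk>a \<in> car; b \<in> car\<rbrakk> \<Longrightarrow> a \<odot> (b \<odot> \<sim>a) = \<zero>"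
  by (simp add: mult_eq_zero_iff)

lemma meet_add_diff: "\<lbrakk>a \<in> car; b \<in> car\<rbrakk> \<Longrightarrow> (a \<sqinter> b) \<oplus> (a \<odot> \<sim>b) = a"
  using meet_neg_add_mult[of "\<sim>b" a] by simp

lemma meet_mult_diff: "\<lbrakk>a \<in> car; b \<in> car\<rbrakk> \<Longrightarrow> (a \<sqinter> b) \<odot> (a \<odot> \<sim>b) = \<zero>"
  using meet_neg_mult_mult[of "\<sim>b" a] by simp

section \<open>States\<close>

context
  fixes s assumes state: "is_state M s"
begin

lemma state_ge_0 [simp]: "a \<in> car \<Longrightarrow> 0 \<le> s a"
  and state_le_1 [simp]: "a \<in> car \<Longrightarrow> s a \<le> 1"
  and state_one [simp]: "s \<one> = 1"
  and state_add: "\<lbrakk>a \<odot> b = \<zero>; a \<in> car; b \<in> car\<rbrakk> \<Longrightarrow> s (a \<oplus> b) = s a + s b"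
  using state by (auto simp: is_state_def)

lemma state_mono: "\<lbrakk>a \<preceq> b; a \<in> car; b \<in> car\<rbrakk> \<Longrightarrow> s a \<le> s b"
  using state_add[of a "b \<odot> \<sim>a"] by (simp add: le_diff_add mult_diff_zero)

lemma state_neg: "a \<in> car \<Longrightarrow> s (\<sim>a) = 1 - s a"
  using state_add[of a "\<sim>a"] by simp

lemma state_zero [simp]: "s \<zero> = 0"
  using state_neg[of \<one>] by simp

lemma state_add_meet_neg: "\<lbrakk>a \<in> car; b \<in> car\<rbrakk> \<Longrightarrow> s (a \<oplus> b) = s a + s (b \<sqinter> \<sim>a)"
  using state_add[of a "b \<sqinter> \<sim>a"] by (simp add: mult_meet_neg add_meet_neg)

text \<open>\<open>a \<oplus> b\<close> is \<open>a\<close> plus the fitting part of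
  \<open>b\<close>, while \<open>a \<odot> b\<close> is the overflow of \<open>b\<close>; the state
  is additive on both splittings.\<close>

lemma state_modular: "\<lbrakk>a \<in> car; b \<in> car\<rbrakk> \<Longrightarrow> s (a \<oplus> b) + s (a \<odot> b) = s a + s b"
  using state_add[of "b \<sqinter> \<sim>a" "b \<odot> a"] state_add_meet_neg[of a b]
  by (simp add: meet_neg_add_mult meet_neg_mult_mult mult_commute[of a b])

lemma state_subadd: "\<lbrakk>a \<in> car; b \<in> car\<rbrakk> \<Longrightarrow> s (a \<oplus> b) \<le> s a + s b"
  using state_modular[of a b] state_ge_0[of "a \<odot> b"] by (simp del: state_ge_0)

lemma state_bisect: "a \<in> car \<Longrightarrow> (s (a \<oplus> a) + s (a \<odot> a)) / 2 = s a"
  using state_modular[of a a] by simp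

text \<open>The disjoint pair is \<open>a \<odot> b\<close> and
  \<open>\<sim>a \<odot> \<sim>b\<close>. If \<open>s\<close> kills the overflow, modularity gives
  \<open>s a + s b\<close>; if it kills the shortfall, the sum has value 1.\<close>

lemma prime_state_hom:
  assumes prime: "\<And>c d. \<lbrakk>c \<in> car; d \<in> car; c \<sqinter> d = \<zero>\<rbrakk> \<Longrightarrow> s c = 0 \<or> s d = 0"
  shows "mv_hom M unit_mv s"
proof -
  have "s (a \<oplus> b) = min (s a + s b) 1" if [simp]: "a \<in> car" "b \<in> car" for a b
  proof -
    have "s (a \<odot> b) = 0 \<or> s (\<sim>a \<odot> \<sim>b) = 0"
      by (intro prime) (simp_all add: disjoint_mult)
    then show ?thesis
    proof
      assume "s (a \<odot> b) = 0"
      then show ?thesis using state_modular[of a b] state_le_1[of "a \<oplus> b"] by (simp del: state_le_1)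
    next
      assume "s (\<sim>a \<odot> \<sim>b) = 0"
      then have "s (a \<oplus> b) = 1" using state_neg[of "a \<oplus> b"] by simp
      then show ?thesis using state_subadd[of a b] by simp
    qed
  qed
  then show ?thesis by (simp add: mv_hom_def unit_mv_def state_neg)
qed

end

section \<open>Homomorphisms into the unit interval\<close>

lemma hom_add: "\<lbrakk>mv_hom M unit_mv s; a \<in> car; b \<in> car\<rbrakk> \<Longrightarrow> s (a \<oplus> b) = min (s a + s b) 1"
  and hom_neg: "\<lbrakk>mv_hom M unit_mv s; a \<in> car\<rbrakk> \<Longrightarrow> s (\<sim>a) = 1 - s a"
  and hom_range: "\<lbrakk>mv_hom M unit_mv s; a \<in> car\<rbrakk> \<Longrightarrow> s a \<in> {0..1}"
  by (simp_all add: mv_hom_def unit_mv_def)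

lemma hom_mult: "\<lbrakk>mv_hom M unit_mv s; a \<in> car; b \<in> car\<rbrakk> \<Longrightarrow> s (a \<odot> b) = max (s a + s b - 1) 0"
  by (simp add: mv_mult_def hom_add hom_neg del: neg_add)

lemma hom_zero: "mv_hom M unit_mv s \<Longrightarrow> s \<zero> = 0"
  by (simp add: mv_hom_def unit_mv_def)

lemma hom_is_state: "mv_hom M unit_mv s \<Longrightarrow> is_state M s"
  unfolding is_state_def
proof (intro conjI ballI impI)
  assume h: "mv_hom M unit_mv s"
  show "s a \<in> {0..1}" if "a \<in> car" for a using hom_range[OF h that] .
  show "s \<one> = 1" using hom_neg[OF h, of \<zero>] hom_zero[OF h] by simp
  show "s (a \<oplus> b) = s a + s b" if "a \<in> car" "b \<in> car" "a \<odot> b = \<zero>" for a b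
    using hom_mult[OF h that(1,2)] hom_zero[OF h] that by (simp add: hom_add[OF h])
qed

text \<open>A state vanishing on the kernel of a homomorphism \<open>s\<close> agrees with \<open>s\<close> after one doubling of
  \<open>a\<close> up to half of the error, because one of \<open>a \<oplus> a\<close>, \<open>a \<odot> a\<close> is sent to an endpoint by both.\<close>

lemma state_eq_hom:
  assumes h: "mv_hom M unit_mv s" and u: "is_state M u"
    and ker: "\<And>a. \<lbrakk>a \<in> car; s a = 0\<rbrakk> \<Longrightarrow> u a = 0" and a: "a \<in> car"
  shows "u a = s a"
proof -
  note s = hom_is_state[OF h]
  define e :: "nat \<Rightarrow> real" where "e n = (1/2) ^ n" for n
  have e_Suc: "e (Suc n) = e n / 2" for n by (simp add: e_def)
  have bound: "\<bar>u a - s a\<bar> \<le> e n" if "a \<in> car" for n a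
    using that
  proof (induction n arbitrary: a)
    case 0
    then show ?case using state_ge_0[OF s 0] state_le_1[OF s 0] state_ge_0[OF u 0] state_le_1[OF u 0] by (simp add: e_def)
  next
    case (Suc n)
    note [simp] = Suc.prems
    have u2: "u a = (u (a \<oplus> a) + u (a \<odot> a)) / 2" and s2: "s a = (s (a \<oplus> a) + s (a \<odot> a)) / 2"
      using state_bisect[OF u, of a] state_bisect[OF s, of a] by simp_all
    have "s (a \<odot> a) = 0 \<or> s (a \<oplus> a) = 1"
      using hom_add[OF h, of a a] hom_mult[OF h, of a a] by auto
    then show ?case
    proof
      assume *: "s (a \<odot> a) = 0"
      then have "u (a \<odot> a) = 0" by (simp add: ker)
      then show ?thesis using Suc.IH[OF add_closed[OF Suc.prems Suc.prems]] * u2 s2 unfolding e_Suc add_divide_distrib by linarith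
    next
      assume *: "s (a \<oplus> a) = 1"
      then have "s (\<sim>(a \<oplus> a)) = 0" using state_neg[OF s, of "a \<oplus> a"] by simp
      then have "u (\<sim>(a \<oplus> a)) = 0" by (intro ker) simp_all
      then have "u (a \<oplus> a) = 1" using state_neg[OF u, of "a \<oplus> a"] by simp
      then show ?thesis using Suc.IH[OF mult_closed[OF Suc.prems Suc.prems]] * u2 s2 unfolding e_Suc add_divide_distrib by linarith
    qed
  qed
  have "e \<longlonglongrightarrow> 0" unfolding e_def by (simp add: LIMSEQ_power_zero)
  then have "\<bar>u a - s a\<bar> \<le> 0"
    using bound[OF a] by (intro LIMSEQ_le_const[of e]) auto
  then show ?thesis by simp
qed

text \<open>Nonnegativity and positive weights force \<open>u\<close> and \<open>v\<close> to vanish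
  on the kernel of \<open>s\<close>, so \<open>state_eq_hom\<close> identifies both with
  \<open>s\<close>.\<close>

lemma hom_extreme:
  assumes h: "mv_hom M unit_mv s" and u: "is_state M u" and v: "is_state M v" and t: "0 < t" "t < 1"
    and eq: "\<And>a. a \<in> car \<Longrightarrow> s a = t * u a + (1 - t) * v a" and a: "a \<in> car"
  shows "u a = v a"
proof -
  have "u a = 0 \<and> v a = 0" if "a \<in> car" "s a = 0" for a
  proof -
    have "0 \<le> t * u a" "0 \<le> (1 - t) * v a" using u v t that by simp_all
    then have "t * u a = 0" "(1 - t) * v a = 0" using eq[OF that(1)] that(2) by linarith+
    then show ?thesis using t by simp
  qed
  then show ?thesis using state_eq_hom[OF h u _ a] state_eq_hom[OF h v _ a] by simp
qed

subsection \<open>Chains\<close>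

text \<open>For \<open>a\<close> and \<open>b\<close> at most 1/2 both sides are
  \<open>2 a + 2 b - 1\<close> truncated at 0. The chain condition decides whether
  \<open>2 a + b\<close> is at most or at least 1, and in each case partial associativity
  applies.\<close>

lemma square_add_small:
  assumes chain: "\<And>a b. \<lbrakk>a \<in> car; b \<in> car\<rbrakk> \<Longrightarrow> a \<odot> b = \<zero> \<or> a \<oplus> b = \<one>"
    and z: "a \<odot> a = \<zero>" "b \<odot> b = \<zero>" "a \<odot> b = \<zero>" and [simp]: "a \<in> car" "b \<in> car"
  shows "(a \<oplus> b) \<odot> (a \<oplus> b) = (a \<oplus> a) \<odot> (b \<oplus> b)"
proof -
  have ba: "b \<odot> a = \<zero>" using z by (simp add: mult_commute)
  consider "a \<odot> (a \<oplus> b) = \<zero>" | "a \<oplus> (a \<oplus> b) = \<one>" using chain[of a "a \<oplus> b"] by auto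
  then show ?thesis
  proof cases
    case 1
    have "(a \<oplus> b) \<odot> (a \<oplus> b) = b \<odot> (a \<oplus> (a \<oplus> b))"
      using mult_add_assoc[of b a "a \<oplus> b"] 1 ba by (simp add: add_commute)
    also have "\<dots> = ((a \<oplus> a) \<oplus> b) \<odot> b" by (simp add: mult_commute add_assoc)
    also have "\<dots> = (a \<oplus> a) \<odot> (b \<oplus> b)"
    proof (rule mult_add_assoc)
      show "(a \<oplus> a) \<odot> b = \<zero>" using mult_add_assoc[of a a b] 1 z by simp
    qed (use z in simp_all)
    finally show ?thesis .
  next
    case 2
    have "(a \<oplus> b) \<odot> (a \<oplus> b) = b \<oplus> (a \<odot> (a \<oplus> b))"
      using add_mult_assoc[of b a "a \<oplus> b"] 2 ba by (simp add: add_commute)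
    also have "a \<odot> (a \<oplus> b) = b \<odot> (a \<oplus> a)"
      using mult_add_assoc[of b a a] ba z by (simp add: mult_commute add_commute)
    also have "b \<oplus> (b \<odot> (a \<oplus> a)) = (b \<oplus> b) \<odot> (a \<oplus> a)"
    proof (rule add_mult_assoc[symmetric])
      show "b \<oplus> (a \<oplus> a) = \<one>" using 2 by (simp add: add_commute add_left_commute)
    qed (use z in simp_all)
    finally show ?thesis by (simp add: mult_commute)
  qed
qed

text \<open>In \<open>[0,1]\<close> both sides are \<open>2 a + 2 b - 1\<close>, reached by two uses
  of \<open>add_mult_assoc\<close>.\<close>

lemma square_add_mixed:
  assumes "a \<odot> b = \<zero>" "b \<oplus> b = \<one>" and [simp]: "a \<in> car" "b \<in> car"
  shows "(a \<oplus> b) \<odot> (a \<oplus> b) = (a \<oplus> a) \<oplus> (b \<odot> b)"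
proof -
  have "(a \<oplus> b) \<odot> (a \<oplus> b) = a \<oplus> (b \<odot> (a \<oplus> b))"
    using assms add_left_commute[of b a b] by (intro add_mult_assoc) simp_all
  also have "b \<odot> (a \<oplus> b) = a \<oplus> (b \<odot> b)"
    using add_mult_assoc[of a b b] assms by (simp add: mult_commute)
  finally show ?thesis by (simp add: add_assoc)
qed


text \<open>On a chain, doubling an element \<open>n\<close> times leaves at most one of the \<open>2 ^ n\<close> iterates outside
  \<open>{\<zero>, \<one>}\<close>, so the upper and lower counts \<open>S n\<close> and \<open>L n\<close> differ by at most \<open>2 ^ - n\<close>.\<close>

lemma chain_state_exists:
  assumes chain: "\<And>a b. \<lbrakk>a \<in> car; b \<in> car\<rbrakk> \<Longrightarrow> a \<odot> b = \<zero> \<or> a \<oplus> b = \<one>"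
    and nontrivial: "\<zero> \<noteq> \<one>"
  shows "\<exists>s. is_state M s"
proof -
  define S L where "S n = (bisect M ^^ n) (\<lambda>x. of_bool (x \<noteq> \<zero>))"
    and "L n = (bisect M ^^ n) (\<lambda>x. of_bool (x = \<one>))" for n
  have S0: "S 0 x = of_bool (x \<noteq> \<zero>)" and L0: "L 0 x = of_bool (x = \<one>)" for x
    by (simp_all add: S_def L_def)
  have SS: "S (Suc n) x = (S n (x \<oplus> x) + S n (x \<odot> x)) / 2"
    and LS: "L (Suc n) x = (L n (x \<oplus> x) + L n (x \<odot> x)) / 2" for n x
    unfolding S_def L_def by (rule bisect_funpow_Suc)+
  have [simp]: "S n \<zero> = 0" "S n \<one> = 1" "L n \<zero> = 0" "L n \<one> = 1" for n
    using nontrivial by (induction n) (simp_all add: S0 L0 SS LS)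
  have L_nonneg: "0 \<le> L n x" if "x \<in> car" for n x
    using that by (induction n arbitrary: x) (simp_all add: L0 LS)
  have S_neg: "S n (\<sim>x) = 1 - L n x" if "x \<in> car" for n x
    using that
  proof (induction n arbitrary: x)
    case 0
    then show ?case using neg_eq_iff[of x \<one>] by (simp add: S0 L0)
  next
    case (Suc n)
    then show ?case using Suc.IH[of "x \<oplus> x"] Suc.IH[of "x \<odot> x"] by (simp add: SS LS field_simps)
  qed
  have half: "x \<odot> x = \<zero> \<or> x \<oplus> x = \<one>" if "x \<in> car" for x using chain that by blast
  define e :: "nat \<Rightarrow> real" where "e n = (1/2) ^ n" for n
  have e_Suc: "e (Suc n) = e n / 2" for n by (simp add: e_def)
  have e_lim: "e \<longlonglongrightarrow> 0" unfolding e_def by (simp add: LIMSEQ_power_zero)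
  have gap: "S n x \<le> L n x + e n" if "x \<in> car" for n x
    using that
  proof (induction n arbitrary: x)
    case (Suc n)
    show ?case
      using half[OF Suc.prems] Suc.IH[OF add_closed[OF Suc.prems Suc.prems]]
        Suc.IH[OF mult_closed[OF Suc.prems Suc.prems]] by (auto simp: SS LS e_Suc add_divide_distrib)
  qed (simp add: S0 L0 e_def)
  have S_dec: "S (Suc n) x \<le> S n x" if "x \<in> car" for n x
    using that
  proof (induction n arbitrary: x)
    case (Suc n)
    show ?case
      using Suc.IH[OF add_closed[OF Suc.prems Suc.prems]] Suc.IH[OF mult_closed[OF Suc.prems Suc.prems]]
      unfolding SS[of "Suc n" x] SS[of n x] by simp
  qed (simp add: SS S0)
  \<comment> \<open>Half of modularity, up to the counting error. With \<open>L\<close> on the left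
    and \<open>S\<close> on the right it already holds for the 0-1 valued functions that start the
    induction.\<close>
  have upper: "L n (a \<oplus> b) + L n (a \<odot> b) \<le> S n a + S n b" if "a \<in> car" "b \<in> car" for n a b
    using that
  proof (induction n arbitrary: a b)
    case 0
    have "a = \<one> \<and> b = \<one>" if "a \<odot> b = \<one>"
      using that 0 mult_le1[of a b] mult_le2[of a b] le_antisym[of a \<one>] le_antisym[of b \<one>] by simp
    then show ?case using 0 nontrivial by (auto simp: S0 L0)
  next
    case (Suc n)
    have mixed: "L (Suc n) (a \<oplus> b) + L (Suc n) (a \<odot> b) \<le> S (Suc n) a + S (Suc n) b"
      if a: "a \<odot> a = \<zero>" and b: "b \<oplus> b = \<one>" and [simp]: "a \<in> car" "b \<in> car" for a b
    proof -
      have IH: "L n ((a \<oplus> a) \<oplus> (b \<odot> b)) + L n ((a \<oplus> a) \<odot> (b \<odot> b)) \<le> S n (a \<oplus> a) + S n (b \<odot> b)"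
        by (intro Suc.IH) simp_all
      consider "a \<odot> b = \<zero>" | "a \<oplus> b = \<one>" using chain[of a b] by auto
      then show ?thesis
      proof cases
        case 1
        have "(a \<oplus> b) \<oplus> (a \<oplus> b) = (a \<oplus> a) \<oplus> (b \<oplus> b)"
          by (simp add: add_assoc add_left_commute)
        then show ?thesis
          using 1 a b IH L_nonneg[of "(a \<oplus> a) \<odot> (b \<odot> b)" n] square_add_mixed[of a b] by (simp add: SS LS add_divide_distrib)
      next
        \<comment> \<open>Dual to the previous case: \<open>square_add_mixed\<close> is applied to
          the negations.\<close>
        case 2
        have "\<sim>(\<sim>((a \<odot> b) \<oplus> (a \<odot> b))) = \<sim>((\<sim>b \<oplus> \<sim>a) \<odot> (\<sim>b \<oplus> \<sim>a))"
          by (simp add: mult_commute)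
        also have "(\<sim>b \<oplus> \<sim>a) \<odot> (\<sim>b \<oplus> \<sim>a) = (\<sim>b \<oplus> \<sim>b) \<oplus> (\<sim>a \<odot> \<sim>a)"
        proof (rule square_add_mixed)
          show "\<sim>b \<odot> \<sim>a = \<zero>" using 2 neg_add[of b a] by (simp add: add_commute del: neg_add)
          show "\<sim>a \<oplus> \<sim>a = \<one>" using a neg_mult[of a a] by (simp del: neg_mult)
        qed simp_all
        finally have dbl: "(a \<odot> b) \<oplus> (a \<odot> b) = (a \<oplus> a) \<odot> (b \<odot> b)" by (simp add: mult_commute)
        have "\<sim>a \<preceq> b" using 2 by (simp add: add_eq_one_iff)
        then have "\<sim>a \<odot> \<sim>a \<preceq> b \<odot> b" by (simp add: mult_mono)
        then have one: "(a \<oplus> a) \<oplus> (b \<odot> b) = \<one>" by (simp add: add_eq_one_iff)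
        have "(a \<odot> b) \<odot> (a \<odot> b) \<preceq> a \<odot> a" by (intro mult_mono) simp_all
        then have "(a \<odot> b) \<odot> (a \<odot> b) = \<zero>" using a by (simp add: le_zero_iff)
        then show ?thesis using 2 a b IH dbl one by (simp add: SS LS add_divide_distrib)
      qed
    qed
    note [simp] = Suc.prems
    consider "a \<odot> a = \<zero>" "b \<odot> b = \<zero>" | "a \<oplus> a = \<one>" "b \<oplus> b = \<one>"
      | "a \<odot> a = \<zero>" "b \<oplus> b = \<one>" | "a \<oplus> a = \<one>" "b \<odot> b = \<zero>"
      using half[of a] half[of b] by auto
    then show ?case
    proof cases
      case 1
      \<comment> \<open>Otherwise \<open>a \<oplus> b = \<one>\<close> with both elements at most
        1/2, which forces \<open>a = b\<close> and contradicts
        \<open>a \<odot> a = \<zero>\<close>.\<close>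
      have ab: "a \<odot> b = \<zero>"
      proof (rule ccontr)
        assume "a \<odot> b \<noteq> \<zero>"
        then have "a \<oplus> b = \<one>" using chain[of a b] by simp
        then have "\<sim>a \<preceq> b" "\<sim>b \<preceq> a" using add_commute[of a b] by (simp_all flip: add_eq_one_iff)
        moreover have "a \<preceq> \<sim>a" "b \<preceq> \<sim>b" using 1 by (simp_all add: mult_eq_zero_iff)
        ultimately have "a = b" using le_trans[of a "\<sim>a" b] le_trans[of b "\<sim>b" a] le_antisym by simp
        then show False using 1 \<open>a \<odot> b \<noteq> \<zero>\<close> by simp
      qed
      have "(a \<oplus> b) \<oplus> (a \<oplus> b) = (a \<oplus> a) \<oplus> (b \<oplus> b)"
        by (simp add: add_assoc add_left_commute)
      moreover have "(a \<oplus> b) \<odot> (a \<oplus> b) = (a \<oplus> a) \<odot> (b \<oplus> b)"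
        using ab 1 chain by (intro square_add_small) simp_all
      ultimately show ?thesis using 1 ab Suc.IH[of "a \<oplus> a" "b \<oplus> b"] by (simp add: SS LS add_divide_distrib)
    next
      \<comment> \<open>Both elements are at least 1/2; their negations fall under
        \<open>square_add_small\<close>.\<close>
      case 2
      have z: "\<sim>a \<odot> \<sim>a = \<zero>" "\<sim>b \<odot> \<sim>b = \<zero>"
        using 2 neg_add[of a a] neg_add[of b b] by (simp_all del: neg_add)
      have ab: "\<sim>a \<odot> \<sim>b = \<zero>"
      proof (rule ccontr)
        assume nz: "\<sim>a \<odot> \<sim>b \<noteq> \<zero>"
        then have "\<sim>a \<oplus> \<sim>b = \<one>" using chain[of "\<sim>a" "\<sim>b"] by simp
        then have "a \<preceq> \<sim>b" by (simp add: add_eq_one_iff)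
        then have "b \<preceq> \<sim>a" by (simp add: le_neg_commute)
        have "\<sim>a \<preceq> a" "\<sim>b \<preceq> b" using z by (simp_all add: mult_eq_zero_iff)
        then have "a = b"
          using \<open>a \<preceq> \<sim>b\<close> \<open>b \<preceq> \<sim>a\<close> le_trans[of a "\<sim>b" b] le_trans[of b "\<sim>a" a] le_antisym by simp
        then show False using z nz by simp
      qed
      then have one: "a \<oplus> b = \<one>" using neg_eq_iff[of "a \<oplus> b" \<one>] by simp
      have "(\<sim>a \<oplus> \<sim>b) \<odot> (\<sim>a \<oplus> \<sim>b) = (\<sim>a \<oplus> \<sim>a) \<odot> (\<sim>b \<oplus> \<sim>b)"
        using ab z chain by (intro square_add_small) simp_all
      then have "\<sim>((a \<odot> b) \<oplus> (a \<odot> b)) = \<sim>((a \<odot> a) \<oplus> (b \<odot> b))" by simp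
      then have "(a \<odot> b) \<oplus> (a \<odot> b) = (a \<odot> a) \<oplus> (b \<odot> b)"
        by (subst (asm) neg_eq_iff) simp_all
      moreover have "(a \<odot> b) \<odot> (a \<odot> b) = (a \<odot> a) \<odot> (b \<odot> b)"
        by (metis Suc.prems mult_assoc mult_closed mult_commute)
      ultimately show ?thesis using 2 one Suc.IH[of "a \<odot> a" "b \<odot> b"] by (simp add: SS LS add_divide_distrib)
    next
      case 3
      then show ?thesis by (intro mixed) simp_all
    next
      case 4
      then show ?thesis using mixed[of b a] by (simp add: add_commute mult_commute)
    qed
  qed
  \<comment> \<open>Negation exchanges the two counts, so the reverse estimate is
    \<open>upper\<close> at negated elements.\<close>
  have lower: "L n a + L n b \<le> S n (a \<oplus> b) + S n (a \<odot> b)" if "a \<in> car" "b \<in> car" for n a b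
    using upper[of "\<sim>a" "\<sim>b" n] S_neg[of "\<sim>(a \<oplus> b)" n] S_neg[of "\<sim>(a \<odot> b)" n]
      S_neg[of a n] S_neg[of b n] that by simp
  have LS_le: "L n x \<le> S n x" if "x \<in> car" for n x
    using upper[of x \<zero> n] that by simp
  define h where "h x = lim (\<lambda>n. S n x)" for x
  have lim_S: "(\<lambda>n. S n x) \<longlonglongrightarrow> h x" if "x \<in> car" for x
  proof -
    have "decseq (\<lambda>n. S n x)" using S_dec that by (intro decseq_SucI)
    moreover have "0 \<le> S n x" for n using L_nonneg[OF that, of n] LS_le[OF that, of n] by simp
    ultimately obtain l where "(\<lambda>n. S n x) \<longlonglongrightarrow> l"
      using decseq_convergent[of "\<lambda>n. S n x" 0] by metis
    then show ?thesis unfolding h_def using limI by blast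
  qed
  have lim_L: "(\<lambda>n. L n x) \<longlonglongrightarrow> h x" if "x \<in> car" for x
  proof (rule real_tendsto_sandwich)
    have "(\<lambda>n. S n x - e n) \<longlonglongrightarrow> h x - 0"
      by (intro tendsto_diff lim_S that e_lim)
    then show "(\<lambda>n. S n x - e n) \<longlonglongrightarrow> h x" by simp
    show "\<forall>\<^sub>F n in sequentially. S n x - e n \<le> L n x"
      using gap[OF that] by (simp add: diff_le_eq)
    show "\<forall>\<^sub>F n in sequentially. L n x \<le> S n x"
      using LS_le[OF that] by simp
  qed (rule lim_S[OF that])
  \<comment> \<open>\<open>S\<close> and \<open>L\<close> share the limit \<open>h\<close>, so the
    two one-sided estimates close up to an equality.\<close>
  have h_modular: "h (a \<oplus> b) + h (a \<odot> b) = h a + h b" if "a \<in> car" "b \<in> car" for a b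
  proof (rule antisym)
    show "h (a \<oplus> b) + h (a \<odot> b) \<le> h a + h b"
      using that upper by (intro LIMSEQ_le[OF tendsto_add[OF lim_L lim_L] tendsto_add[OF lim_S lim_S]]) auto
    show "h a + h b \<le> h (a \<oplus> b) + h (a \<odot> b)"
      using that lower by (intro LIMSEQ_le[OF tendsto_add[OF lim_L lim_L] tendsto_add[OF lim_S lim_S]]) auto
  qed
  have h0: "h \<zero> = 0" and h1: "h \<one> = 1"
    by (simp_all add: h_def)
  have h_nonneg: "0 \<le> h x" if "x \<in> car" for x
    using L_nonneg that by (intro LIMSEQ_le_const[OF lim_L]) auto
  have "is_state M h"
    unfolding is_state_def
  proof (intro conjI ballI impI h1)
    show "h a \<in> {0..1}" if "a \<in> car" for a
      using h_nonneg[of a] h_nonneg[of "\<sim>a"] h_modular[of a "\<sim>a"] that h0 h1 by simp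
    show "h (a \<oplus> b) = h a + h b" if "a \<in> car" "b \<in> car" "a \<odot> b = \<zero>" for a b
      using h_modular[of a b] that h0 by simp
  qed
  then show ?thesis by blast
qed

subsection \<open>Ideals and quotients\<close>

fun nmul :: "nat \<Rightarrow> 'a \<Rightarrow> 'a" where
  "nmul 0 a = \<zero>"
| "nmul (Suc n) a = a \<oplus> nmul n a"

lemma nmul_closed [simp]: "a \<in> car \<Longrightarrow> nmul n a \<in> car"
  by (induction n) auto

lemma nmul_add: "a \<in> car \<Longrightarrow> nmul (m + n) a = nmul m a \<oplus> nmul n a"
  by (induction m) (auto simp: add_assoc)

lemma disjoint_nmul: "\<lbrakk>d \<sqinter> c = \<zero>; c \<in> car; d \<in> car\<rbrakk> \<Longrightarrow> d \<sqinter> nmul n c = \<zero>"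
  by (induction n) (auto intro: disjoint_add)

lemma dist_closed [simp]: "\<lbrakk>a \<in> car; b \<in> car\<rbrakk> \<Longrightarrow> mv_dist M a b \<in> car"
  by (simp add: mv_dist_def)

context
  fixes I assumes ideal: "mv_ideal M I"
begin

lemma ideal_car: "a \<in> I \<Longrightarrow> a \<in> car"
  and ideal_zero [simp]: "\<zero> \<in> I"
  and ideal_down: "\<lbrakk>b \<preceq> a; a \<in> I; b \<in> car\<rbrakk> \<Longrightarrow> b \<in> I"
  and ideal_add: "\<lbrakk>a \<in> I; b \<in> I\<rbrakk> \<Longrightarrow> a \<oplus> b \<in> I"
  using ideal unfolding mv_ideal_def by blast+

lemma dist_in_ideal_iff:
  "\<lbrakk>a \<in> car; b \<in> car\<rbrakk> \<Longrightarrow> mv_dist M a b \<in> I \<longleftrightarrow> a \<odot> \<sim>b \<in> I \<and> b \<odot> \<sim>a \<in> I"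
  using ideal_down[of "a \<odot> \<sim>b" "mv_dist M a b"] ideal_down[of "b \<odot> \<sim>a" "mv_dist M a b"]
  by (auto simp: mv_dist_def intro: ideal_add)

text \<open>\<open>a \<odot> \<sim>b \<in> I\<close> says that \<open>a\<close> is below
  \<open>b\<close> modulo \<open>I\<close>. The triangle inequality for truncated differences makes
  this relation transitive; its symmetric part is the congruence of \<open>I\<close>.\<close>

lemma diff_trans:
  assumes "a \<odot> \<sim>b \<in> I" "b \<odot> \<sim>c \<in> I" and [simp]: "a \<in> car" "b \<in> car" "c \<in> car"
  shows "a \<odot> \<sim>c \<in> I"
proof (rule ideal_down)
  have "a \<preceq> b \<oplus> (a \<odot> \<sim>b)" "b \<preceq> c \<oplus> (b \<odot> \<sim>c)" by (simp_all flip: residuation)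
  then have "a \<preceq> (c \<oplus> (b \<odot> \<sim>c)) \<oplus> (a \<odot> \<sim>b)"
    using add_mono[of b "c \<oplus> (b \<odot> \<sim>c)" "a \<odot> \<sim>b" "a \<odot> \<sim>b"] le_trans[of a "b \<oplus> (a \<odot> \<sim>b)"] by simp
  then show "a \<odot> \<sim>c \<preceq> (b \<odot> \<sim>c) \<oplus> (a \<odot> \<sim>b)" by (simp add: residuation add_assoc)
qed (use assms in \<open>auto intro: ideal_add\<close>)

lemma diff_add:
  assumes "a \<odot> \<sim>c \<in> I" "b \<odot> \<sim>d \<in> I" and [simp]: "a \<in> car" "b \<in> car" "c \<in> car" "d \<in> car"
  shows "(a \<oplus> b) \<odot> \<sim>(c \<oplus> d) \<in> I"
proof (rule ideal_down)
  have "a \<preceq> c \<oplus> (a \<odot> \<sim>c)" "b \<preceq> d \<oplus> (b \<odot> \<sim>d)" by (simp_all flip: residuation)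
  then have "a \<oplus> b \<preceq> (c \<oplus> (a \<odot> \<sim>c)) \<oplus> (d \<oplus> (b \<odot> \<sim>d))" by (simp add: add_mono)
  also have "\<dots> = (c \<oplus> d) \<oplus> ((a \<odot> \<sim>c) \<oplus> (b \<odot> \<sim>d))"
    by (simp add: add_assoc add_left_commute)
  finally show "(a \<oplus> b) \<odot> \<sim>(c \<oplus> d) \<preceq> (a \<odot> \<sim>c) \<oplus> (b \<odot> \<sim>d)" by (simp add: residuation del: neg_add)
qed (use assms in \<open>auto intro: ideal_add\<close>)

lemma class_eq_iff:
  assumes [simp]: "a \<in> car" "b \<in> car"
  shows "mv_class M I a = mv_class M I b \<longleftrightarrow> a \<odot> \<sim>b \<in> I \<and> b \<odot> \<sim>a \<in> I"
proof
  assume "mv_class M I a = mv_class M I b"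
  moreover have "b \<in> mv_class M I b" by (simp add: mv_class_def dist_in_ideal_iff)
  ultimately have "b \<in> mv_class M I a" by simp
  then show "a \<odot> \<sim>b \<in> I \<and> b \<odot> \<sim>a \<in> I"
    by (simp add: mv_class_def dist_in_ideal_iff)
next
  assume "a \<odot> \<sim>b \<in> I \<and> b \<odot> \<sim>a \<in> I"
  then have "mv_dist M a x \<in> I \<longleftrightarrow> mv_dist M b x \<in> I" if "x \<in> car" for x
    using that diff_trans[of a b x] diff_trans[of b a x] diff_trans[of x a b] diff_trans[of x b a]
    by (auto simp: dist_in_ideal_iff)
  then show "mv_class M I a = mv_class M I b" by (auto simp: mv_class_def)
qed

text \<open>The quotient operations act on representatives picked by \<open>SOME\<close>; these
  facts trade the pick for any named representative.\<close>

lemma some_in_class: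
  assumes [simp]: "a \<in> car"
  shows "(SOME x. x \<in> mv_class M I a) \<in> car"
    and "mv_class M I (SOME x. x \<in> mv_class M I a) = mv_class M I a"
proof -
  have "a \<in> mv_class M I a" by (simp add: mv_class_def dist_in_ideal_iff)
  then have "(SOME x. x \<in> mv_class M I a) \<in> mv_class M I a" by (rule someI)
  then have *: "(SOME x. x \<in> mv_class M I a) \<in> car \<and> mv_dist M a (SOME x. x \<in> mv_class M I a) \<in> I"
    unfolding mv_class_def by blast
  then show "(SOME x. x \<in> mv_class M I a) \<in> car" ..
  with * show "mv_class M I (SOME x. x \<in> mv_class M I a) = mv_class M I a"
    by (simp add: dist_in_ideal_iff class_eq_iff)
qed

lemma quot_car: "mv_car (mv_quot M I) = mv_class M I ` car"
  and quot_zero: "mv_zero (mv_quot M I) = mv_class M I \<zero>"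
  by (simp_all add: mv_quot_def)

lemma quot_add:
  assumes "a \<in> car" "b \<in> car"
  shows "mv_add (mv_quot M I) (mv_class M I a) (mv_class M I b) = mv_class M I (a \<oplus> b)"
  using some_in_class[OF assms(1)] some_in_class[OF assms(2)] assms
  by (simp add: mv_quot_def class_eq_iff diff_add del: neg_add)

lemma quot_neg:
  assumes "a \<in> car"
  shows "mv_neg (mv_quot M I) (mv_class M I a) = mv_class M I (\<sim>a)"
  using some_in_class[OF assms] assms
  by (simp add: mv_quot_def class_eq_iff mult_commute[of "\<sim>_"])

lemma quot_one: "mv_one (mv_quot M I) = mv_class M I \<one>"
  by (simp add: mv_one_def[of "mv_quot M I"] quot_zero quot_neg)

lemma quot_mult:
  "\<lbrakk>a \<in> car; b \<in> car\<rbrakk> \<Longrightarrow> mv_mult (mv_quot M I) (mv_class M I a) (mv_class M I b) = mv_class M I (a \<odot> b)"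
  by (simp add: mv_mult_def quot_add quot_neg del: neg_add)

lemma quot_mv_algebra: "mv_algebra (mv_quot M I)"
  unfolding mv_algebra_def quot_car quot_zero quot_one
proof (intro conjI ballI)
  fix X Y assume "X \<in> mv_class M I ` car" "Y \<in> mv_class M I ` car"
  then obtain a b where ab: "a \<in> car" "b \<in> car" "X = mv_class M I a" "Y = mv_class M I b" by auto
  let ?add = "mv_add (mv_quot M I)" and ?neg = "mv_neg (mv_quot M I)"
  show "?add X Y = ?add Y X" using ab by (simp add: quot_add add_commute)
  show "?add (?neg (?add (?neg X) Y)) Y = ?add (?neg (?add (?neg Y) X)) X"
    using ab lukasiewicz[of a b] by (simp add: quot_add quot_neg del: neg_add)
qed (auto simp: quot_add quot_neg add_assoc)

lemma class_eq_zero_iff: "a \<in> car \<Longrightarrow> mv_class M I a = mv_class M I \<zero> \<longleftrightarrow> a \<in> I"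
  by (simp add: class_eq_iff)

lemma class_eq_one_iff: "a \<in> car \<Longrightarrow> mv_class M I a = mv_class M I \<one> \<longleftrightarrow> \<sim>a \<in> I"
  by (simp add: class_eq_iff)

end

text \<open>\<open>J\<close> is the ideal generated by \<open>m\<close> and \<open>c\<close>. By
  maximality \<open>\<one>\<close> is a sum of some \<open>i \<in> m\<close> and a multiple of
  \<open>c\<close>; meeting with \<open>d\<close> removes the multiple, so
  \<open>d \<preceq> i\<close>.\<close>

lemma max_ideal_prime:
  assumes m: "m \<in> mv_max_ideals M" and cd: "c \<sqinter> d = \<zero>" and [simp]: "c \<in> car" "d \<in> car"
  shows "d \<in> m \<or> c \<in> m"
proof (rule disjCI)
  assume "c \<notin> m"
  have I: "mv_ideal M m" using m by (simp add: mv_max_ideals_def)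
  note mcar = ideal_car[OF I]
  define J where "J = {x \<in> car. \<exists>i\<in>m. \<exists>n. x \<preceq> i \<oplus> nmul n c}"
  have "mv_ideal M J"
    unfolding mv_ideal_def
  proof (intro conjI ballI impI)
    show "J \<subseteq> car" by (auto simp: J_def)
    show "\<zero> \<in> J" using ideal_zero[OF I] by (auto simp: J_def intro!: bexI[of _ \<zero>])
    show "b \<in> J" if "a \<in> J" "b \<in> car" "b \<preceq> a" for a b
    proof -
      from \<open>a \<in> J\<close> obtain i n where "i \<in> m" "a \<preceq> i \<oplus> nmul n c" "a \<in> car"
        unfolding J_def by blast
      moreover from calculation that mcar have "b \<preceq> i \<oplus> nmul n c" by (auto intro: le_trans[of b a])
      ultimately show ?thesis using that unfolding J_def by blast
    qed
    show "a \<oplus> b \<in> J" if "a \<in> J" "b \<in> J" for a b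
    proof -
      from that obtain i n j k where *: "i \<in> m" "a \<preceq> i \<oplus> nmul n c" "a \<in> car"
        "j \<in> m" "b \<preceq> j \<oplus> nmul k c" "b \<in> car" unfolding J_def by blast
      then have "a \<oplus> b \<preceq> (i \<oplus> nmul n c) \<oplus> (j \<oplus> nmul k c)" by (simp add: add_mono mcar)
      also have "\<dots> = (i \<oplus> j) \<oplus> nmul (n + k) c"
        using * by (simp add: nmul_add mcar add_assoc add_left_commute)
      finally show ?thesis using * ideal_add[OF I] add_closed unfolding J_def by blast
    qed
  qed
  moreover have "m \<subseteq> J" using mcar by (auto simp: J_def intro!: bexI exI[of _ 0])
  moreover have "c \<in> J" using ideal_zero[OF I] by (auto simp: J_def intro!: bexI[of _ \<zero>] exI[of _ 1])
  ultimately have "J = car" using m \<open>c \<notin> m\<close> by (auto simp: mv_max_ideals_def)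
  then have "\<one> \<in> J" by simp
  then obtain i n where i: "i \<in> m" "\<one> \<preceq> i \<oplus> nmul n c" unfolding J_def by blast
  then have "i \<oplus> nmul n c = \<one>" using mcar le_antisym[of \<one> "i \<oplus> nmul n c"] by simp
  then have "d \<preceq> (d \<sqinter> i) \<oplus> (d \<sqinter> nmul n c)"
    using meet_add_le[of d i "nmul n c"] i mcar by simp
  also have "d \<sqinter> nmul n c = \<zero>" using cd by (intro disjoint_nmul) (simp_all add: meet_commute)
  finally have "d \<preceq> d \<sqinter> i" using i mcar by simp
  then have "d \<preceq> i" using le_trans[of d "d \<sqinter> i" i] i mcar by simp
  then show "d \<in> m" using ideal_down[OF I] i by simp
qed

lemma state_kernel_ideal:
  assumes "is_state M s"
  shows "mv_ideal M {a \<in> car. s a = 0}"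
  unfolding mv_ideal_def
proof (intro conjI ballI impI)
  show "b \<in> {a \<in> car. s a = 0}" if "a \<in> {a \<in> car. s a = 0}" "b \<in> car" "b \<preceq> a" for a b
    using that state_mono[OF assms, of b a] state_ge_0[OF assms, of b] by simp
  show "a \<oplus> b \<in> {a \<in> car. s a = 0}" if "a \<in> {a \<in> car. s a = 0}" "b \<in> {a \<in> car. s a = 0}" for a b
    using that state_subadd[OF assms, of a b] state_ge_0[OF assms, of "a \<oplus> b"] by simp
qed (use state_zero[OF assms] in auto)

text \<open>If \<open>s b > 0\<close>, some multiple of \<open>b\<close> has value 1 by the
  Archimedean property, and its negation lies in the kernel. An ideal strictly above the kernel
  therefore contains \<open>\<one>\<close>.\<close>

lemma hom_kernel_max_ideal:
  assumes h: "mv_hom M unit_mv s"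
  shows "{a \<in> car. s a = 0} \<in> mv_max_ideals M"
proof -
  note s = hom_is_state[OF h]
  let ?K = "{a \<in> car. s a = 0}"
  have "J = car" if J: "mv_ideal M J" and K: "?K \<subseteq> J" and ne: "J \<noteq> ?K" for J
  proof -
    from K ne obtain b where b: "b \<in> J" "b \<notin> ?K" by blast
    then have [simp]: "b \<in> car" and pos: "s b > 0"
      using ideal_car[OF J] state_ge_0[OF s, of b] by (auto simp: less_le)
    have nmul: "s (nmul n b) = min (real n * s b) 1" for n
      by (induction n) (use pos in \<open>auto simp: hom_zero[OF h] hom_add[OF h] min_def algebra_simps\<close>)
    obtain n where "1 < real n * s b" using reals_Archimedean3[OF pos] by blast
    then have "s (\<sim>(nmul n b)) = 0" by (simp add: hom_neg[OF h] nmul)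
    then have "\<sim>(nmul n b) \<in> J" using K by auto
    moreover have "nmul n b \<in> J" by (induction n) (use b J in \<open>auto intro: ideal_add ideal_zero\<close>)
    ultimately have "\<sim>(nmul n b) \<oplus> nmul n b \<in> J" using ideal_add[OF J] by blast
    then have "\<one> \<in> J" by simp
    then show ?thesis using ideal_down[OF J _ \<open>\<one> \<in> J\<close>] ideal_car[OF J] by auto
  qed
  moreover have "\<one> \<notin> ?K" using state_one[OF s] by simp
  ultimately show ?thesis
    using state_kernel_ideal[OF s] one_closed unfolding mv_max_ideals_def by blast
qed

text \<open>Primeness gives the quotient the chain condition and hence a state. Pulled back to
  \<open>M\<close>, the kernel of this state is a proper ideal containing \<open>m\<close>, so it
  equals \<open>m\<close>; primeness then turns the state into a homomorphism.\<close>

lemma max_ideal_hom_exists: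
  assumes m: "m \<in> mv_max_ideals M"
  obtains s where "mv_hom M unit_mv s" "\<And>a. a \<in> car \<Longrightarrow> s a = 0 \<longleftrightarrow> a \<in> m"
proof -
  have I: "mv_ideal M m" and "m \<noteq> car" using m by (simp_all add: mv_max_ideals_def)
  have "\<one> \<notin> m" using ideal_down[OF I, of _ \<one>] ideal_car[OF I] \<open>m \<noteq> car\<close> le_one by blast
  interpret Q: mv_alg "mv_quot M m" by unfold_locales (rule quot_mv_algebra[OF I])
  have "\<exists>t. is_state (mv_quot M m) t"
  proof (rule Q.chain_state_exists)
    show "Q.zero \<noteq> Q.one"
      using class_eq_zero_iff[OF I, of \<one>] \<open>\<one> \<notin> m\<close> by (auto simp: quot_zero[OF I] quot_one[OF I])
    fix X Y assume "X \<in> Q.car" "Y \<in> Q.car"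
    then obtain a b where ab: "a \<in> car" "b \<in> car" "X = mv_class M m a" "Y = mv_class M m b"
      by (auto simp: quot_car[OF I])
    have "a \<odot> b \<in> m \<or> \<sim>(a \<oplus> b) \<in> m"
      using max_ideal_prime[OF m disjoint_mult[of a b]] ab by auto
    then show "Q.mult X Y = Q.zero \<or> Q.add X Y = Q.one"
      using ab by (simp add: quot_mult[OF I] quot_zero[OF I] quot_one[OF I] quot_add[OF I]
          class_eq_zero_iff[OF I] class_eq_one_iff[OF I] del: neg_add)
  qed
  then obtain t where t: "is_state (mv_quot M m) t" by blast
  define s where "s a = t (mv_class M m a)" for a
  have s: "is_state M s"
    unfolding is_state_def
  proof (intro conjI ballI impI)
    show "s a \<in> {0..1}" if "a \<in> car" for a
      using Q.state_ge_0[OF t] Q.state_le_1[OF t] that by (simp add: s_def quot_car[OF I])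
    show "s \<one> = 1" using Q.state_one[OF t] by (simp add: s_def quot_one[OF I])
    show "s (a \<oplus> b) = s a + s b" if "a \<in> car" "b \<in> car" "a \<odot> b = \<zero>" for a b
      using Q.state_add[OF t, of "mv_class M m a" "mv_class M m b"] that
      by (simp add: s_def quot_car[OF I] quot_add[OF I] quot_mult[OF I] quot_zero[OF I])
  qed
  have "s a = 0" if "a \<in> m" for a
    using Q.state_zero[OF t] that class_eq_zero_iff[OF I, of a] ideal_car[OF I]
    by (simp add: s_def quot_zero[OF I])
  then have "m \<subseteq> {a \<in> car. s a = 0}" using ideal_car[OF I] by auto
  moreover have "{a \<in> car. s a = 0} \<noteq> car" using state_one[OF s] one_closed by (metis (mono_tags, lifting) mem_Collect_eq zero_neq_one)
  ultimately have ker: "{a \<in> car. s a = 0} = m"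
    using m state_kernel_ideal[OF s] unfolding mv_max_ideals_def by blast
  have "mv_hom M unit_mv s"
  proof (rule prime_state_hom[OF s])
    show "s c = 0 \<or> s d = 0" if "c \<in> car" "d \<in> car" "c \<sqinter> d = \<zero>" for c d
      using max_ideal_prime[OF m that(3,1,2)] ker by auto
  qed
  then show thesis using that[of s] ker by auto
qed

text \<open>For existence, \<open>s\<close> factors injectively through the quotient, since
  \<open>a \<odot> \<sim>b \<in> m\<close> means \<open>s a \<le> s b\<close>. For uniqueness, a
  competing embedding pulled back to \<open>M\<close> vanishes on the kernel of \<open>s\<close>,
  and \<open>state_eq_hom\<close> applies.\<close>

lemma astar_eq_hom:
  assumes m: "m \<in> mv_max_ideals M" and s: "mv_hom M unit_mv s"
    and ker: "\<And>a. a \<in> car \<Longrightarrow> s a = 0 \<longleftrightarrow> a \<in> m" and [simp]: "a \<in> car"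
  shows "astar M a m = s a"
  unfolding astar_def
proof (rule the_equality)
  have I: "mv_ideal M m" using m by (simp add: mv_max_ideals_def)
  have diff: "a \<odot> \<sim>b \<in> m \<longleftrightarrow> s a \<le> s b" if "a \<in> car" "b \<in> car" for a b
    using that ker[of "a \<odot> \<sim>b"] by (simp add: hom_mult[OF s] hom_neg[OF s] max_def split: if_splits)
  define h where "h X = s (SOME x. x \<in> X)" for X
  have h: "h (mv_class M m b) = s b" if "b \<in> car" for b
    using some_in_class[OF I that] that
    by (auto simp: h_def class_eq_iff[OF I] diff)
  have "mv_hom (mv_quot M m) unit_mv h"
    unfolding mv_hom_def using s
    by (auto simp: quot_car[OF I] quot_add[OF I] quot_neg[OF I] quot_zero[OF I] h mv_hom_def)
  moreover have "inj_on h (mv_car (mv_quot M m))"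
    by (auto simp: inj_on_def quot_car[OF I] h class_eq_iff[OF I] diff)
  ultimately show "\<exists>h. mv_hom (mv_quot M m) unit_mv h \<and> inj_on h (mv_car (mv_quot M m)) \<and>
      h (mv_class M m a) = s a"
    using h[of a] by auto
  fix r
  assume "\<exists>h. mv_hom (mv_quot M m) unit_mv h \<and> inj_on h (mv_car (mv_quot M m)) \<and>
      h (mv_class M m a) = r"
  then obtain h where h: "mv_hom (mv_quot M m) unit_mv h" and r: "h (mv_class M m a) = r" by blast
  have "mv_hom M unit_mv (\<lambda>b. h (mv_class M m b))"
    using h unfolding mv_hom_def
    by (auto simp: quot_car[OF I] quot_zero[OF I] simp flip: quot_add[OF I] quot_neg[OF I])
  then have "h (mv_class M m a) = s a"
  proof (intro state_eq_hom[OF s hom_is_state])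
    show "h (mv_class M m b) = 0" if "b \<in> car" "s b = 0" for b
      using that ker[of b] class_eq_zero_iff[OF I, of b] h
      by (simp add: mv_hom_def quot_zero[OF I] unit_mv_def)
  qed simp_all
  then show "r = s a" using r by simp
qed

lemma astar_hom:
  assumes "m \<in> mv_max_ideals M"
  shows "mv_hom M unit_mv (\<lambda>a. astar M a m)" and "\<And>a. a \<in> car \<Longrightarrow> astar M a m = 0 \<longleftrightarrow> a \<in> m"
proof -
  obtain s where s: "mv_hom M unit_mv s" "\<And>a. a \<in> car \<Longrightarrow> s a = 0 \<longleftrightarrow> a \<in> m"
    using max_ideal_hom_exists[OF assms] by blast
  note eq = astar_eq_hom[OF assms s]
  show "mv_hom M unit_mv (\<lambda>a. astar M a m)"
    using s(1) by (simp add: mv_hom_def eq)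
  show "\<And>a. a \<in> car \<Longrightarrow> astar M a m = 0 \<longleftrightarrow> a \<in> m" using s(2) eq by simp
qed


subsection \<open>Products with an element under a state\<close>

lemma meet_add_meet_glb:
  assumes "t \<preceq> a \<oplus> c" "t \<preceq> a \<oplus> d" "t \<preceq> b \<oplus> c" "t \<preceq> b \<oplus> d"
    and [simp]: "a \<in> car" "b \<in> car" "c \<in> car" "d \<in> car" "t \<in> car"
  shows "t \<preceq> (a \<sqinter> b) \<oplus> (c \<sqinter> d)"
proof -
  have "t \<preceq> a \<oplus> (c \<sqinter> d)" "t \<preceq> b \<oplus> (c \<sqinter> d)"
    using assms by (simp_all add: add_meet_glb)
  then show ?thesis by (simp add: add_meet_glb add_commute[of _ "c \<sqinter> d"])
qed

lemma meet_mult_meet_glb: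
  assumes "t \<preceq> a \<odot> c" "t \<preceq> a \<odot> d" "t \<preceq> b \<odot> c" "t \<preceq> b \<odot> d"
    and [simp]: "a \<in> car" "b \<in> car" "c \<in> car" "d \<in> car" "t \<in> car"
  shows "t \<preceq> (a \<sqinter> b) \<odot> (c \<sqinter> d)"
proof -
  have "t \<preceq> a \<odot> (c \<sqinter> d)" "t \<preceq> b \<odot> (c \<sqinter> d)"
    using assms by (simp_all add: mult_meet_glb)
  then show ?thesis by (simp add: mult_meet_glb mult_commute[of _ "c \<sqinter> d"])
qed

text \<open>In \<open>[0,1]\<close> the square \<open>x \<odot> x\<close> is nonzero only where
  \<open>x \<oplus> x\<close> has already reached 1.\<close>

lemma double_add_square:
  assumes [simp]: "x \<in> car"
  shows "(x \<oplus> x) \<oplus> (x \<odot> x) \<preceq> x \<oplus> x"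
proof -
  have *: "(x \<odot> x) \<sqinter> \<sim>(x \<oplus> x) = \<zero>" using disjoint_mult[of x x] by simp
  have "(x \<oplus> x) \<oplus> (x \<odot> x) = (x \<oplus> x) \<oplus> ((x \<odot> x) \<sqinter> \<sim>(x \<oplus> x))"
    by (simp add: add_meet_neg del: neg_add)
  also have "\<dots> = x \<oplus> x" unfolding * by simp
  finally show ?thesis by simp
qed

text \<open>On \<open>[0,1]\<close> the base is the tent of height 1/2, and \<open>tents n\<close>
  is a row of \<open>2 ^ n\<close> teeth. It controls the error of the \<open>n\<close>-th
  approximation to the product.\<close>

fun tents :: "nat \<Rightarrow> 'a \<Rightarrow> 'a" where
  "tents 0 x = x \<sqinter> \<sim>x"
| "tents (Suc n) x = tents n (x \<oplus> x) \<oplus> tents n (x \<odot> x)"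

lemma tents_closed [simp]: "x \<in> car \<Longrightarrow> tents n x \<in> car"
  by (induction n arbitrary: x) auto

lemma tent_double_le:
  assumes [simp]: "x \<in> car"
  shows "(x \<oplus> x) \<sqinter> \<sim>(x \<oplus> x) \<preceq> (x \<sqinter> \<sim>x) \<oplus> (x \<sqinter> \<sim>x)"
proof (rule meet_add_meet_glb)
  let ?t = "(x \<oplus> x) \<sqinter> \<sim>(x \<oplus> x)"
  have n: "?t \<preceq> \<sim>x"
    using le_trans[of ?t "\<sim>(x \<oplus> x)" "\<sim>x"] by simp
  show "?t \<preceq> x \<oplus> x" by simp
  show "?t \<preceq> x \<oplus> \<sim>x" "?t \<preceq> \<sim>x \<oplus> x" by simp_all
  show "?t \<preceq> \<sim>x \<oplus> \<sim>x" using n le_trans[of ?t "\<sim>x" "\<sim>x \<oplus> \<sim>x"] by simp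
qed simp_all

lemma tent_square_le:
  assumes [simp]: "x \<in> car"
  shows "(x \<odot> x) \<sqinter> \<sim>(x \<odot> x) \<preceq> (x \<sqinter> \<sim>x) \<oplus> (x \<sqinter> \<sim>x)"
  using tent_double_le[of "\<sim>x"] by (simp add: meet_commute)

text \<open>Passing to \<open>x \<oplus> x\<close> or \<open>x \<odot> x\<close> at most doubles the
  tent, so supports do not grow.\<close>

lemma tents_disjoint:
  assumes "x \<in> car" "z \<in> car" "z \<sqinter> (x \<sqinter> \<sim>x) = \<zero>"
  shows "z \<sqinter> tents n x = \<zero>"
  using assms
proof (induction n arbitrary: x)
  case (Suc n)
  note [simp] = Suc.prems(1,2)
  have *: "z \<sqinter> ((x \<sqinter> \<sim>x) \<oplus> (x \<sqinter> \<sim>x)) = \<zero>" using Suc.prems by (intro disjoint_add) simp_all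
  have "z \<sqinter> ((x \<oplus> x) \<sqinter> \<sim>(x \<oplus> x)) = \<zero>"
    by (rule disjoint_mono[OF le_refl tent_double_le *]) simp_all
  moreover have "z \<sqinter> ((x \<odot> x) \<sqinter> \<sim>(x \<odot> x)) = \<zero>"
    by (rule disjoint_mono[OF le_refl tent_square_le *]) simp_all
  ultimately show ?case using Suc.IH[of "x \<oplus> x"] Suc.IH[of "x \<odot> x"] by (simp add: disjoint_add)
qed simp

text \<open>The two rows live where \<open>x\<close> is below and above 1/2. Disjointness of the
  base tents is carried to each row in turn, and a state then adds the rows exactly.\<close>

lemma tents_split_disjoint:
  assumes [simp]: "x \<in> car"
  shows "tents n (x \<oplus> x) \<odot> tents n (x \<odot> x) = \<zero>"
proof (rule disjoint_imp_mult_zero)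
  have "((x \<oplus> x) \<sqinter> \<sim>(x \<oplus> x)) \<sqinter> ((x \<odot> x) \<sqinter> \<sim>(x \<odot> x)) = \<zero>"
  proof (rule disjoint_mono)
    show "(\<sim>x \<odot> \<sim>x) \<sqinter> (x \<odot> x) = \<zero>"
      using disjoint_mult[of x x] by (simp add: meet_commute)
    show "(x \<oplus> x) \<sqinter> \<sim>(x \<oplus> x) \<preceq> \<sim>x \<odot> \<sim>x"
      using meet_le2[of "x \<oplus> x" "\<sim>(x \<oplus> x)"] by simp
  qed simp_all
  then have "((x \<oplus> x) \<sqinter> \<sim>(x \<oplus> x)) \<sqinter> tents n (x \<odot> x) = \<zero>"
    by (intro tents_disjoint) simp_all
  then have "tents n (x \<odot> x) \<sqinter> ((x \<oplus> x) \<sqinter> \<sim>(x \<oplus> x)) = \<zero>"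
    by (subst meet_commute) simp_all
  then have "tents n (x \<odot> x) \<sqinter> tents n (x \<oplus> x) = \<zero>"
    by (intro tents_disjoint) simp_all
  then show "tents n (x \<oplus> x) \<sqinter> tents n (x \<odot> x) = \<zero>"
    by (subst meet_commute) simp_all
qed simp_all

text \<open>If \<open>s\<close> is integration against a measure \<open>\<mu>\<close> on \<open>Max M\<close>, then \<open>state_approx s n x g\<close>
  decreases to \<open>\<integral> x g d\<mu>\<close>: the product obeys \<open>2 x g = (x \<oplus> x) g + (x \<odot> x) g\<close>, and \<open>x \<sqinter> g\<close> is a
  first approximation to it.\<close>

definition state_approx :: "('a \<Rightarrow> real) \<Rightarrow> nat \<Rightarrow> 'a \<Rightarrow> 'a \<Rightarrow> real" where
  "state_approx s n x g = (bisect M ^^ n) (\<lambda>x. s (x \<sqinter> g)) x"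

definition state_prod :: "('a \<Rightarrow> real) \<Rightarrow> 'a \<Rightarrow> 'a \<Rightarrow> real" where
  "state_prod s x g = lim (\<lambda>n. state_approx s n x g)"

lemma state_approx_0: "state_approx s 0 x g = s (x \<sqinter> g)"
  by (simp add: state_approx_def)

lemma state_approx_Suc:
  "state_approx s (Suc n) x g = state_approx s n (x \<oplus> x) g / 2 + state_approx s n (x \<odot> x) g / 2"
  unfolding state_approx_def bisect_funpow_Suc by (simp add: add_divide_distrib)

section \<open>Convergence, error and additivity of the product approximations\<close>

context
  fixes s assumes state: "is_state M s"
begin

lemma state_bisect': "x \<in> car \<Longrightarrow> s x = s (x \<oplus> x) / 2 + s (x \<odot> x) / 2"
  using state_bisect[OF state, of x] by (simp add: add_divide_distrib)

text \<open>Comparing the truncated sums and the truncated products separately, and adding by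
  modularity, gives the untruncated inequality. It starts the induction for monotone
  decrease.\<close>

lemma state_meet_bisect:
  assumes [simp]: "x \<in> car" "g \<in> car"
  shows "s ((x \<oplus> x) \<sqinter> g) / 2 + s ((x \<odot> x) \<sqinter> g) / 2 \<le> s (x \<sqinter> g)"
proof -
  let ?u = "(x \<oplus> x) \<sqinter> g" and ?v = "(x \<odot> x) \<sqinter> g" and ?z = "x \<sqinter> g"
  have vx: "?v \<preceq> x" using le_trans[of ?v "x \<odot> x" x] by simp
  have "?u \<oplus> ?v \<preceq> ?z \<oplus> ?z"
  proof (rule meet_add_meet_glb)
    have "?u \<oplus> ?v \<preceq> (x \<oplus> x) \<oplus> (x \<odot> x)" by (intro add_mono) simp_all
    then show "?u \<oplus> ?v \<preceq> x \<oplus> x"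
      using double_add_square[of x] le_trans[of "?u \<oplus> ?v" "(x \<oplus> x) \<oplus> (x \<odot> x)" "x \<oplus> x"] by simp
    show "?u \<oplus> ?v \<preceq> g \<oplus> x" using vx by (intro add_mono) simp_all
    then show "?u \<oplus> ?v \<preceq> x \<oplus> g" by (simp add: add_commute[of x g])
    show "?u \<oplus> ?v \<preceq> g \<oplus> g" by (intro add_mono) simp_all
  qed simp_all
  moreover have "?u \<odot> ?v \<preceq> ?z \<odot> ?z"
  proof (rule meet_mult_meet_glb)
    have "?u \<odot> ?v \<preceq> ?v" by simp
    then show "?u \<odot> ?v \<preceq> x \<odot> x" using le_trans[of "?u \<odot> ?v" ?v "x \<odot> x"] by simp
    show "?u \<odot> ?v \<preceq> g \<odot> x" "?u \<odot> ?v \<preceq> g \<odot> g" using vx by (auto intro: mult_mono)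
    then show "?u \<odot> ?v \<preceq> x \<odot> g" by (simp add: mult_commute[of x g])
  qed simp_all
  ultimately have "s (?u \<oplus> ?v) \<le> s (?z \<oplus> ?z)" "s (?u \<odot> ?v) \<le> s (?z \<odot> ?z)"
    by (simp_all add: state_mono[OF state])
  then show ?thesis
    using state_modular[OF state, of ?u ?v] state_modular[OF state, of ?z ?z] by simp
qed

text \<open>Substitute for superadditivity, which \<open>x \<sqinter> g\<close> lacks in
  \<open>g\<close>; after negation it yields superadditivity of the limit. Again sums and products
  are compared separately.\<close>

lemma state_meet_supermodular:
  assumes uv: "u \<oplus> v = \<one>" and [simp]: "x \<in> car" "u \<in> car" "v \<in> car"
  shows "s x + s (x \<sqinter> (u \<odot> v)) \<le> s (x \<sqinter> u) + s (x \<sqinter> v)"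
proof -
  let ?k = "x \<sqinter> (u \<odot> v)"
  have k: "?k \<preceq> u \<odot> v" by simp
  have ku: "?k \<preceq> u" using k le_trans[of ?k "u \<odot> v" u] by simp
  have kv: "?k \<preceq> v" using k le_trans[of ?k "u \<odot> v" v] by simp
  have "x \<oplus> ?k \<preceq> (x \<sqinter> u) \<oplus> (x \<sqinter> v)"
  proof (rule meet_add_meet_glb)
    show "x \<oplus> ?k \<preceq> x \<oplus> x" "x \<oplus> ?k \<preceq> x \<oplus> v" using kv by (simp_all add: add_mono_right)
    have "x \<oplus> ?k \<preceq> x \<oplus> u" using ku by (simp add: add_mono_right)
    then show "x \<oplus> ?k \<preceq> u \<oplus> x" by (simp add: add_commute[of u x])
    show "x \<oplus> ?k \<preceq> u \<oplus> v" by (simp add: uv)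
  qed simp_all
  moreover have "x \<odot> ?k \<preceq> (x \<sqinter> u) \<odot> (x \<sqinter> v)"
  proof (rule meet_mult_meet_glb)
    show "x \<odot> ?k \<preceq> x \<odot> x" "x \<odot> ?k \<preceq> x \<odot> v" using kv by (auto intro: mult_mono)
    have "x \<odot> ?k \<preceq> x \<odot> u" using ku by (auto intro: mult_mono)
    then show "x \<odot> ?k \<preceq> u \<odot> x" by (simp add: mult_commute[of u x])
    show "x \<odot> ?k \<preceq> u \<odot> v" using k le_trans[of "x \<odot> ?k" ?k "u \<odot> v"] by simp
  qed simp_all
  ultimately have "s (x \<oplus> ?k) \<le> s ((x \<sqinter> u) \<oplus> (x \<sqinter> v))" "s (x \<odot> ?k) \<le> s ((x \<sqinter> u) \<odot> (x \<sqinter> v))"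
    by (simp_all add: state_mono[OF state])
  then show ?thesis
    using state_modular[OF state, of x ?k] state_modular[OF state, of "x \<sqinter> u" "x \<sqinter> v"] by simp
qed

text \<open>\<open>x \<sqinter> g\<close> and \<open>x \<odot> \<sim>g\<close> add up to
  \<open>x\<close>, and \<open>x \<sqinter> \<sim>g\<close> exceeds the latter by at most the tent
  of \<open>x\<close>.\<close>

lemma state_meet_gap:
  assumes [simp]: "x \<in> car" "g \<in> car"
  shows "s (x \<sqinter> g) + s (x \<sqinter> \<sim>g) \<le> s x + s (x \<sqinter> \<sim>x)"
proof -
  have "x \<sqinter> \<sim>g \<preceq> (x \<odot> \<sim>g) \<oplus> (x \<sqinter> \<sim>x)"
  proof (rule add_meet_glb)
    show "x \<sqinter> \<sim>g \<preceq> x \<odot> \<sim>g \<oplus> x" using le_trans[of "x \<sqinter> \<sim>g" x] by simp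
    have "\<sim>g \<preceq> \<sim>x \<oplus> (\<sim>g \<odot> x)" using residuation[of "\<sim>g" "\<sim>x" "\<sim>g \<odot> x"] by simp
    then show "x \<sqinter> \<sim>g \<preceq> x \<odot> \<sim>g \<oplus> \<sim>x"
      using le_trans[of "x \<sqinter> \<sim>g" "\<sim>g"] by (simp add: add_commute mult_commute)
  qed simp_all
  then have "s (x \<sqinter> \<sim>g) \<le> s ((x \<odot> \<sim>g) \<oplus> (x \<sqinter> \<sim>x))" by (simp add: state_mono[OF state])
  also have "\<dots> \<le> s (x \<odot> \<sim>g) + s (x \<sqinter> \<sim>x)" by (simp add: state_subadd[OF state])
  finally show ?thesis
    using state_add[OF state meet_mult_diff[of x g]] by (simp add: meet_add_diff)
qed

lemma state_approx_dec:
  assumes "x \<in> car" "g \<in> car"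
  shows "state_approx s (Suc n) x g \<le> state_approx s n x g"
  using assms(1)
proof (induction n arbitrary: x)
  case 0
  then show ?case using state_meet_bisect[of x g] assms by (simp add: state_approx_Suc state_approx_0)
next
  case (Suc n)
  show ?case
    using Suc.IH[OF add_closed[OF Suc.prems Suc.prems]] Suc.IH[OF mult_closed[OF Suc.prems Suc.prems]]
    unfolding state_approx_Suc[of s "Suc n" x] state_approx_Suc[of s n x] by simp
qed

lemma state_approx_one: "x \<in> car \<Longrightarrow> state_approx s n x \<one> = s x"
  by (induction n arbitrary: x) (simp_all add: state_approx_0 state_approx_Suc flip: state_bisect')

lemma state_approx_nonneg: "\<lbrakk>x \<in> car; g \<in> car\<rbrakk> \<Longrightarrow> 0 \<le> state_approx s n x g"
  by (induction n arbitrary: x) (simp_all add: state_approx_0 state_approx_Suc state_ge_0[OF state])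

lemma state_approx_subadd:
  "\<lbrakk>x \<in> car; g \<in> car; h \<in> car\<rbrakk> \<Longrightarrow> state_approx s n x (g \<oplus> h) \<le> state_approx s n x g + state_approx s n x h"
proof (induction n arbitrary: x)
  case 0
  then show ?case
    using state_mono[OF state meet_add_le[of x g h]] state_subadd[OF state, of "x \<sqinter> g" "x \<sqinter> h"]
    by (simp add: state_approx_0)
next
  case (Suc n)
  note [simp] = Suc.prems
  have "state_approx s n (x \<oplus> x) (g \<oplus> h) \<le> state_approx s n (x \<oplus> x) g + state_approx s n (x \<oplus> x) h"
    "state_approx s n (x \<odot> x) (g \<oplus> h) \<le> state_approx s n (x \<odot> x) g + state_approx s n (x \<odot> x) h"
    by (simp_all add: Suc.IH)
  then show ?case unfolding state_approx_Suc by linarith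
qed

lemma state_approx_supermodular:
  assumes uv: "u \<oplus> v = \<one>" and "x \<in> car" "u \<in> car" "v \<in> car"
  shows "s x + state_approx s n x (u \<odot> v) \<le> state_approx s n x u + state_approx s n x v"
  using assms(2)
proof (induction n arbitrary: x)
  case 0
  then show ?case using state_meet_supermodular[OF uv, of x] assms by (simp add: state_approx_0)
next
  case (Suc n)
  show ?case
    using Suc.IH[OF add_closed[OF Suc.prems Suc.prems]] Suc.IH[OF mult_closed[OF Suc.prems Suc.prems]]
      state_bisect'[OF Suc.prems] unfolding state_approx_Suc by linarith
qed

text \<open>Each step halves the weight while the rows of tents stay disjoint, so \<open>s\<close>
  adds them; since \<open>s (tents n x) \<le> 1\<close>, the bound is independent of
  \<open>s\<close>.\<close>

lemma state_approx_gap: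
  assumes "x \<in> car" "g \<in> car"
  shows "state_approx s n x g + state_approx s n x (\<sim>g) \<le> s x + (1/2) ^ n"
proof -
  define e :: "nat \<Rightarrow> real" where "e n = (1/2) ^ n" for n
  have "state_approx s n x g + state_approx s n x (\<sim>g) \<le> s x + e n * s (tents n x)"
    using assms(1)
  proof (induction n arbitrary: x)
    case 0
    then show ?case using state_meet_gap[of x g] assms by (simp add: state_approx_0 e_def)
  next
    case (Suc n)
    have "s (tents (Suc n) x) = s (tents n (x \<oplus> x)) + s (tents n (x \<odot> x))"
      using state_add[OF state tents_split_disjoint] Suc.prems by simp
    then have "e (Suc n) * s (tents (Suc n) x) = e n * s (tents n (x \<oplus> x)) / 2 + e n * s (tents n (x \<odot> x)) / 2"
      by (simp add: e_def algebra_simps)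
    then show ?case
      using Suc.IH[OF add_closed[OF Suc.prems Suc.prems]] Suc.IH[OF mult_closed[OF Suc.prems Suc.prems]]
        state_bisect'[OF Suc.prems] unfolding state_approx_Suc by linarith
  qed
  also have "e n * s (tents n x) \<le> e n"
    using state_le_1[OF state, of "tents n x"] assms by (simp add: e_def mult_left_le)
  finally show ?thesis by (simp add: e_def)
qed

lemma state_prod_LIMSEQ:
  assumes "x \<in> car" "g \<in> car"
  shows "(\<lambda>n. state_approx s n x g) \<longlonglongrightarrow> state_prod s x g"
proof -
  have "decseq (\<lambda>n. state_approx s n x g)" using state_approx_dec assms by (intro decseq_SucI)
  then obtain l where "(\<lambda>n. state_approx s n x g) \<longlonglongrightarrow> l"
    using decseq_convergent[of "\<lambda>n. state_approx s n x g" 0] state_approx_nonneg[OF assms] by metis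
  then show ?thesis unfolding state_prod_def using limI by blast
qed

lemma state_prod_le_approx:
  assumes "x \<in> car" "g \<in> car"
  shows "state_prod s x g \<le> state_approx s n x g"
  using state_approx_dec assms by (intro decseq_ge[OF _ state_prod_LIMSEQ] decseq_SucI)

lemma state_prod_nonneg:
  assumes "x \<in> car" "g \<in> car"
  shows "0 \<le> state_prod s x g"
  using state_approx_nonneg[OF assms] by (intro LIMSEQ_le_const[OF state_prod_LIMSEQ[OF assms]]) auto

text \<open>The lower bound is subadditivity on \<open>g \<oplus> \<sim>g = \<one>\<close>; the
  upper bound is the gap estimate, whose error tends to 0.\<close>

lemma state_prod_neg:
  assumes [simp]: "x \<in> car" "g \<in> car"
  shows "state_prod s x g + state_prod s x (\<sim>g) = s x"
proof (rule antisym)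
  have lim: "(\<lambda>n. state_approx s n x g + state_approx s n x (\<sim>g)) \<longlonglongrightarrow> state_prod s x g + state_prod s x (\<sim>g)"
    by (intro tendsto_add state_prod_LIMSEQ) simp_all
  show "s x \<le> state_prod s x g + state_prod s x (\<sim>g)"
    using state_approx_subadd[of x g "\<sim>g"] state_approx_one[of x]
    by (intro LIMSEQ_le_const[OF lim]) auto
  have "(\<lambda>n. s x + (1/2) ^ n) \<longlonglongrightarrow> s x + 0"
    by (intro tendsto_add tendsto_const LIMSEQ_power_zero) simp
  then show "state_prod s x g + state_prod s x (\<sim>g) \<le> s x"
    using state_approx_gap[of x g] by (intro LIMSEQ_le[OF lim]) auto
qed

text \<open>The approximations for \<open>g\<close> and \<open>\<sim>g\<close> both lie above their
  limits, so the bound on their joint excess bounds each one.\<close>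

lemma state_approx_error:
  assumes "x \<in> car" "g \<in> car"
  shows "\<bar>state_approx s n x g - state_prod s x g\<bar> \<le> (1/2) ^ n"
  using state_prod_le_approx[OF assms, of n] state_prod_le_approx[OF assms(1) neg_closed[OF assms(2)], of n]
    state_prod_neg[OF assms] state_approx_gap[OF assms, of n] by linarith

lemma state_prod_one: "x \<in> car \<Longrightarrow> state_prod s x \<one> = s x"
  using state_prod_LIMSEQ[of x \<one>] by (simp add: state_approx_one LIMSEQ_const_iff)

text \<open>One inequality is subadditivity; the other is the supermodular estimate at the
  negations, carried back by \<open>state_prod_neg\<close>.\<close>

lemma state_prod_add:
  assumes gh: "g \<odot> h = \<zero>" and [simp]: "x \<in> car" "g \<in> car" "h \<in> car"
  shows "state_prod s x (g \<oplus> h) = state_prod s x g + state_prod s x h"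
proof (rule antisym)
  show "state_prod s x (g \<oplus> h) \<le> state_prod s x g + state_prod s x h"
    using state_approx_subadd[of x g h]
    by (intro LIMSEQ_le[OF state_prod_LIMSEQ tendsto_add[OF state_prod_LIMSEQ state_prod_LIMSEQ]]) auto
  have "\<sim>g \<oplus> \<sim>h = \<one>" using gh neg_mult[of g h] by (simp del: neg_mult)
  then have "s x + state_prod s x (\<sim>g \<odot> \<sim>h) \<le> state_prod s x (\<sim>g) + state_prod s x (\<sim>h)"
    using state_approx_supermodular[of "\<sim>g" "\<sim>h" x]
    by (intro LIMSEQ_le[OF tendsto_add[OF tendsto_const state_prod_LIMSEQ]
          tendsto_add[OF state_prod_LIMSEQ state_prod_LIMSEQ]]) auto
  then show "state_prod s x g + state_prod s x h \<le> state_prod s x (g \<oplus> h)"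
    using state_prod_neg[of x g] state_prod_neg[of x h] state_prod_neg[of x "g \<oplus> h"] by simp
qed

lemma state_prod_le:
  assumes "x \<in> car" "g \<in> car"
  shows "state_prod s x g \<le> s (x \<sqinter> g)"
  using state_prod_le_approx[OF assms, of 0] by (simp add: state_approx_0)

text \<open>The perturbation is additive and vanishes at \<open>\<one>\<close>. Nonnegativity
  follows from \<open>0 \<le> state_prod s x g \<le> s g\<close> and
  \<open>0 \<le> s x \<le> 1\<close>; the upper bound 1 follows by negation.\<close>

lemma state_perturb:
  assumes [simp]: "x \<in> car" and c: "c = 1 \<or> c = -1"
  shows "is_state M (\<lambda>g. s g + c * (state_prod s x g - s x * s g))"
  unfolding is_state_def
proof (intro conjI ballI impI)
  let ?r = "\<lambda>g. s g + c * (state_prod s x g - s x * s g)"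
  show one: "?r \<one> = 1" by (simp add: state_prod_one state_one[OF state])
  show add: "?r (a \<oplus> b) = ?r a + ?r b" if "a \<in> car" "b \<in> car" "a \<odot> b = \<zero>" for a b
    using that by (simp add: state_prod_add state_add[OF state] algebra_simps)
  have nonneg: "0 \<le> ?r g" if [simp]: "g \<in> car" for g
  proof -
    have "0 \<le> s g * (1 - s x)" "0 \<le> s x * s g" using state_ge_0[OF state] state_le_1[OF state] by simp_all
    moreover have "state_prod s x g \<le> s g"
      using state_prod_le[of x g] state_mono[OF state, of "x \<sqinter> g" g] by simp
    ultimately show ?thesis using c state_prod_nonneg[of x g] by (auto simp: algebra_simps)
  qed
  show "?r a \<in> {0..1}" if [simp]: "a \<in> car" for a
    using nonneg[of a] nonneg[of "\<sim>a"] add[of a "\<sim>a"] one by simp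
qed

end

subsection \<open>Probability maps into \<open>C(Y)\<close>\<close>

lemma PMC_continuous: "\<lbrakk>p \<in> PMC M; a \<in> car\<rbrakk> \<Longrightarrow> continuous_on UNIV (p a)"
  by (simp add: PMC_def prob_map_def CY_def)

lemma PMC_state:
  assumes "p \<in> PMC M"
  shows "is_state M (\<lambda>a. p a y)"
proof -
  have rng: "0 \<le> p a y \<and> p a y \<le> 1" if "a \<in> car" for a
    using assms that by (simp add: PMC_def prob_map_def CY_def)
  have add: "p (a \<oplus> b) y = min (p a y + p (b \<sqinter> \<sim>a) y) 1" if "a \<in> car" "b \<in> car" for a b
    using assms that by (simp add: PMC_def prob_map_def CY_def)
  have neg: "p (\<sim>a) y = 1 - p a y" if "a \<in> car" for a
    using assms that by (simp add: PMC_def prob_map_def CY_def)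
  have one: "p \<one> y = 1"
    using assms by (simp add: PMC_def prob_map_def CY_def mv_one_def[of "\<lparr>mv_car = _, mv_add = _, mv_neg = _, mv_zero = _\<rparr>"])
  show ?thesis
    unfolding is_state_def
  proof (intro conjI ballI impI one)
    show "p a y \<in> {0..1}" if "a \<in> car" for a using rng[OF that] by simp
    fix a b assume [simp]: "a \<in> car" "b \<in> car" and ab: "a \<odot> b = \<zero>"
    have le: "b \<preceq> \<sim>a" using ab by (simp add: mult_eq_zero_iff le_neg_commute)
    \<comment> \<open>(P1) for \<open>\<sim>a\<close>, split into \<open>b\<close> and a remainder,
      gives \<open>p b y \<le> 1 - p a y\<close>. This rules out truncation in
      \<open>p (a \<oplus> b)\<close>.\<close>
    then have "p (\<sim>a) y = min (p b y + p ((\<sim>a \<odot> \<sim>b) \<sqinter> \<sim>b) y) 1"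
      using add[of b "\<sim>a \<odot> \<sim>b"] by (simp add: le_diff_add)
    then have "p b y \<le> 1 - p a y" using rng[of b] rng[of "(\<sim>a \<odot> \<sim>b) \<sqinter> \<sim>b"] by (simp add: neg)
    then show "p (a \<oplus> b) y = p a y + p b y"
      using add[of a b] le by (simp add: meet_absorb)
  qed
qed

text \<open>(P1) is additivity on \<open>a\<close> and \<open>b \<sqinter> \<sim>a\<close>; the
  minimum with 1 changes nothing because states are bounded by 1.\<close>

lemma PMC_I:
  assumes st: "\<And>y. is_state M (\<lambda>a. p a y)" and cont: "\<And>a. a \<in> car \<Longrightarrow> continuous_on UNIV (p a)"
    and out: "\<And>a. a \<notin> car \<Longrightarrow> p a = (\<lambda>y. 0)"
  shows "p \<in> PMC M"
proof -
  have "p (a \<oplus> b) = (\<lambda>y. min (p a y + p (b \<sqinter> \<sim>a) y) 1)" if "a \<in> car" "b \<in> car" for a b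
  proof
    fix y
    show "p (a \<oplus> b) y = min (p a y + p (b \<sqinter> \<sim>a) y) 1"
      using state_add_meet_neg[OF st[of y], of a b] state_le_1[OF st[of y], of "a \<oplus> b"] that by simp
  qed
  moreover have "p (\<sim>a) = (\<lambda>y. 1 - p a y)" if "a \<in> car" for a
    using state_neg[OF st] that by auto
  moreover have "p \<one> = (\<lambda>y. 1)" using state_one[OF st] by auto
  ultimately show ?thesis
    using cont out state_ge_0[OF st] state_le_1[OF st]
    by (auto simp: PMC_def prob_map_def CY_def mv_one_def[of "\<lparr>mv_car = _, mv_add = _, mv_neg = _, mv_zero = _\<rparr>"])
qed

lemma PMC_outside: "\<lbrakk>p \<in> PMC M; a \<notin> car\<rbrakk> \<Longrightarrow> p a = (\<lambda>y. 0)"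
  by (simp add: PMC_def)

lemma PMC_hom_iff:
  fixes p :: "'a \<Rightarrow> 'y::topological_space \<Rightarrow> real"
  assumes "p \<in> PMC M"
  shows "mv_hom M CY p \<longleftrightarrow> (\<forall>y. mv_hom M unit_mv (\<lambda>a. p a y))"
proof -
  have "p a \<in> mv_car CY" if "a \<in> car" for a using assms that by (simp add: PMC_def prob_map_def)
  moreover from this have "p a y \<in> {0..1}" if "a \<in> car" for a y using that by (auto simp: CY_def)
  ultimately show ?thesis
    unfolding mv_hom_def by (auto simp: CY_def unit_mv_def fun_eq_iff)
qed

lemma state_approx_continuous:
  assumes p: "p \<in> PMC M" and "x \<in> car" "g \<in> car"
  shows "continuous_on UNIV (\<lambda>y. state_approx (\<lambda>a. p a y) n x g)"
  using assms(2)
proof (induction n arbitrary: x)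
  case 0
  then show ?case using PMC_continuous[OF p, of "x \<sqinter> g"] assms by (simp add: state_approx_0)
next
  case (Suc n)
  then show ?case unfolding state_approx_Suc by (intro continuous_intros) simp_all
qed

text \<open>The error bound \<open>(1/2) ^ n\<close> is common to all the states at the points
  \<open>y\<close>, so the limit is uniform.\<close>

lemma state_prod_continuous:
  assumes p: "p \<in> PMC M" and "x \<in> car" "g \<in> car"
  shows "continuous_on UNIV (\<lambda>y. state_prod (\<lambda>a. p a y) x g)"
proof (rule uniform_limit_theorem)
  show "\<forall>\<^sub>F n in sequentially. continuous_on UNIV (\<lambda>y. state_approx (\<lambda>a. p a y) n x g)"
    using state_approx_continuous[OF assms] by simp
  show "uniform_limit UNIV (\<lambda>n y. state_approx (\<lambda>a. p a y) n x g)
      (\<lambda>y. state_prod (\<lambda>a. p a y) x g) sequentially"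
  proof (rule uniform_limitI)
    fix e :: real assume "0 < e"
    have "(\<lambda>n. (1/2 :: real) ^ n) \<longlonglongrightarrow> 0" by (simp add: LIMSEQ_power_zero)
    then have "\<forall>\<^sub>F n in sequentially. (1/2 :: real) ^ n < e" using \<open>0 < e\<close> by (rule order_tendstoD)
    then show "\<forall>\<^sub>F n in sequentially. \<forall>y\<in>UNIV.
        dist (state_approx (\<lambda>a. p a y) n x g) (state_prod (\<lambda>a. p a y) x g) < e"
    proof (rule eventually_mono, intro ballI)
      fix n y assume "(1/2 :: real) ^ n < e"
      then show "dist (state_approx (\<lambda>a. p a y) n x g) (state_prod (\<lambda>a. p a y) x g) < e"
        using state_approx_error[OF PMC_state[OF p, of y] assms(2,3), of n] by (simp add: dist_real_def)
    qed
  qed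
qed simp

section \<open>Extreme probability maps\<close>

lemma is_state_cong:
  assumes s: "is_state M s" and eq: "\<And>a. a \<in> car \<Longrightarrow> r a = s a"
  shows "is_state M r"
  unfolding is_state_def
proof (intro conjI ballI impI)
  show "r (a \<oplus> b) = r a + r b" if "a \<in> car" "b \<in> car" "a \<odot> b = \<zero>" for a b
    using state_add[OF s that(3,1,2)] that by (simp add: eq)
qed (use s eq in \<open>simp_all add: state_ge_0 state_le_1 state_one\<close>)

text \<open>\<open>p\<close> is the midpoint of its two perturbations, which are probability maps
  since the product varies continuously with \<open>y\<close>; extremality makes them equal.\<close>

lemma extreme_state_prod:
  assumes p: "p \<in> ext2 (PMC M)" and [simp]: "x \<in> car" and g: "g \<in> car"
  shows "state_prod (\<lambda>a. p a y) x g = p x y * p g y"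
proof -
  have P: "p \<in> PMC M" using p by (simp add: ext2_def)
  \<comment> \<open>The value 0 off the carrier is what \<open>PMC\<close> demands.\<close>
  define u where "u c g = (if g \<in> car then (\<lambda>y. p g y + c * (state_prod (\<lambda>a. p a y) x g - p x y * p g y)) else (\<lambda>y. 0))"
    for c :: real and g
  have u: "u c \<in> PMC M" if "c = 1 \<or> c = -1" for c
  proof (rule PMC_I)
    fix y
    show "is_state M (\<lambda>a. u c a y)"
      by (rule is_state_cong[OF state_perturb[OF PMC_state[OF P, of y], of x c]]) (use that in \<open>simp_all add: u_def\<close>)
  next
    fix a assume a: "a \<in> car"
    then show "continuous_on UNIV (u c a)"
      unfolding u_def by (simp, intro continuous_intros PMC_continuous[OF P] state_prod_continuous[OF P]) simp_all
  qed (simp add: u_def)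
  have "p = (\<lambda>i j. 1/2 * u 1 i j + (1 - 1/2) * u (-1) i j)"
    using PMC_outside[OF P] by (auto simp: u_def fun_eq_iff field_simps)
  moreover have "\<forall>t. 0 < t \<and> t < 1 \<and> p = (\<lambda>i j. t * u 1 i j + (1 - t) * u (-1) i j) \<longrightarrow> u 1 = u (-1)"
    using p u[of 1] u[of "-1"] unfolding ext2_def by blast
  ultimately have "u 1 = u (-1)" by (elim allE[of _ "1/2"]) simp
  then have "u 1 g y = u (-1) g y" by simp
  then show ?thesis using g by (simp add: u_def)
qed

text \<open>For disjoint \<open>c\<close> and \<open>d\<close> the product
  \<open>p c y * p d y\<close> is a \<open>state_prod\<close>, hence at most
  \<open>p (c \<sqinter> d) y = 0\<close>.\<close>

lemma extreme_imp_hom: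
  fixes p :: "'a \<Rightarrow> 'y::topological_space \<Rightarrow> real"
  assumes p: "p \<in> ext2 (PMC M)"
  shows "mv_hom M CY p"
proof -
  have P: "p \<in> PMC M" using p by (simp add: ext2_def)
  have "mv_hom M unit_mv (\<lambda>a. p a y)" for y
  proof (rule prime_state_hom[OF PMC_state[OF P]])
    fix c d assume cd: "c \<in> car" "d \<in> car" "c \<sqinter> d = \<zero>"
    have st: "is_state M (\<lambda>a. p a y)" by (rule PMC_state[OF P])
    have "p c y * p d y \<le> p \<zero> y"
      using state_prod_le[OF st cd(1,2)] extreme_state_prod[OF p cd(1,2), of y] cd(3) by simp
    moreover have "0 \<le> p c y * p d y" using state_ge_0[OF st] cd by simp
    ultimately have "p c y * p d y = 0" using state_zero[OF st] by linarith
    then show "p c y = 0 \<or> p d y = 0" by simp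
  qed
  then show ?thesis using PMC_hom_iff[OF P] by blast
qed

lemma hom_imp_extreme_state:
  assumes p: "p \<in> PMC M" and h: "mv_hom M CY p"
  shows "dual p y \<in> ext1 (states M)"
  unfolding ext1_def
proof (intro CollectI conjI ballI allI impI)
  have hy: "mv_hom M unit_mv (\<lambda>a. p a y)" using h PMC_hom_iff[OF p] by blast
  show "dual p y \<in> states M"
    using PMC_state[OF p, of y] PMC_outside[OF p] by (simp add: states_def dual_def)
  fix u v t
  assume uv: "u \<in> states M" "v \<in> states M"
    and t: "0 < t \<and> t < 1 \<and> dual p y = (\<lambda>i. t * u i + (1 - t) * v i)"
  have "u a = v a" for a
  proof (cases "a \<in> car")
    case True
    show ?thesis
      by (rule hom_extreme[OF hy, of u v t a]) (use uv t True in \<open>auto simp: states_def dual_def fun_eq_iff\<close>)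
  next
    case False
    then show ?thesis using uv by (simp add: states_def)
  qed
  then show "u = v" by auto
qed

text \<open>Evaluating a convex decomposition of \<open>p\<close> at \<open>y\<close> decomposes the
  state at \<open>y\<close>.\<close>

lemma extreme_states_imp_extreme:
  assumes p: "p \<in> PMC M" and e: "\<And>y. dual p y \<in> ext1 (states M)"
  shows "p \<in> ext2 (PMC M)"
  unfolding ext2_def
proof (intro CollectI conjI ballI allI impI p)
  fix u v t
  assume uv: "u \<in> PMC M" "v \<in> PMC M"
    and t: "0 < t \<and> t < 1 \<and> p = (\<lambda>i j. t * u i j + (1 - t) * v i j)"
  have "dual u y = dual v y" for y
  proof -
    have st: "dual w y \<in> states M" if "w \<in> PMC M" for w
      using PMC_state[OF that, of y] PMC_outside[OF that] by (simp add: states_def dual_def)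
    have "dual p y = (\<lambda>i. t * dual u y i + (1 - t) * dual v y i)"
      using t by (simp add: dual_def fun_eq_iff)
    then show ?thesis using e[of y] st[OF uv(1)] st[OF uv(2)] t unfolding ext1_def by blast
  qed
  then show "u = v" by (auto simp: dual_def fun_eq_iff)
qed

text \<open>\<open>dual\<close> is injective and commutes with convex combinations.\<close>

lemma extreme_iff_dual_extreme:
  fixes p :: "'a \<Rightarrow> 'y::topological_space \<Rightarrow> real"
  shows "p \<in> ext2 (PMC M) \<longleftrightarrow> dual p \<in> ext2 (PMC' M)"
proof -
  have inj: "dual u = dual v \<longleftrightarrow> u = v" for u v :: "'a \<Rightarrow> 'y \<Rightarrow> real"
    by (auto simp: dual_def fun_eq_iff)
  have comb: "dual p = (\<lambda>i j. t * dual u i j + (1 - t) * dual v i j) \<longleftrightarrow>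
      p = (\<lambda>i j. t * u i j + (1 - t) * v i j)" for t and p u v :: "'a \<Rightarrow> 'y \<Rightarrow> real"
    by (auto simp: dual_def fun_eq_iff)
  have mem: "dual p \<in> PMC' M \<longleftrightarrow> p \<in> PMC M" for p :: "'a \<Rightarrow> 'y \<Rightarrow> real"
    by (auto simp: PMC'_def inj)
  show ?thesis
    unfolding ext2_def mem_Collect_eq mem by (simp add: PMC'_def comb inj)
qed

section \<open>Continuous maps into the maximal ideal space\<close>

lemma topspace_max_topology: "topspace (max_topology M) = mv_max_ideals M"
proof -
  have "\<exists>a\<in>car. a \<notin> m" if "m \<in> mv_max_ideals M" for m
    using that by (auto simp: mv_max_ideals_def mv_ideal_def)
  then show ?thesis unfolding max_topology_def topology_generated_by_topspace by blast
qed

text \<open>\<open>f y\<close> must be the kernel of the state at \<open>y\<close>, since the zero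
  set of \<open>a \<mapsto> astar M a m\<close> recovers \<open>m\<close>. Continuity is tested on
  the generating open sets: the preimage of \<open>{m. a \<notin> m}\<close> is the open set where
  \<open>p a\<close> is nonzero.\<close>

lemma hom_iff_unique_continuous:
  fixes p :: "'a \<Rightarrow> 'y::topological_space \<Rightarrow> real"
  assumes p: "p \<in> PMC M"
  shows "mv_hom M CY p \<longleftrightarrow> (\<exists>!f. continuous_map euclidean (max_topology M) f \<and>
                (\<forall>a \<in> car. p a = (\<lambda>y. astar M a (f y))))"
proof
  assume "mv_hom M CY p"
  then have h: "mv_hom M unit_mv (\<lambda>a. p a y)" for y using PMC_hom_iff[OF p] by blast
  define f where "f y = {a \<in> car. p a y = 0}" for y
  have max: "f y \<in> mv_max_ideals M" for y unfolding f_def by (rule hom_kernel_max_ideal[OF h])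
  show "\<exists>!f. continuous_map euclidean (max_topology M) f \<and> (\<forall>a \<in> car. p a = (\<lambda>y. astar M a (f y)))"
  proof (rule ex1I[of _ f], intro conjI ballI)
    show "continuous_map euclidean (max_topology M) f"
      unfolding max_topology_def
    proof (rule continuous_on_generated_topo)
      show "f ` topspace euclidean \<subseteq> \<Union> {{m \<in> mv_max_ideals M. a \<notin> m} |a. a \<in> car}"
        using max topspace_max_topology by (auto simp: max_topology_def)
      fix U assume "U \<in> {{m \<in> mv_max_ideals M. a \<notin> m} |a. a \<in> car}"
      then obtain a where a: "a \<in> car" "U = {m \<in> mv_max_ideals M. a \<notin> m}" by blast
      have "f -` U \<inter> topspace euclidean = p a -` (- {0})" using a max by (auto simp: f_def)
      moreover have "open (p a -` (- {0}))"
        using PMC_continuous[OF p a(1)] by (intro open_vimage) auto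
      ultimately show "openin euclidean (f -` U \<inter> topspace euclidean)" by simp
    qed
    show "p a = (\<lambda>y. astar M a (f y))" if "a \<in> car" for a
      using astar_eq_hom[OF max h] that by (auto simp: f_def)
    fix f' assume f': "continuous_map euclidean (max_topology M) f' \<and> (\<forall>a\<in>car. p a = (\<lambda>y. astar M a (f' y)))"
    show "f' = f"
    proof
      fix y
      have m: "f' y \<in> mv_max_ideals M"
        using f' continuous_map_image_subset_topspace[of euclidean "max_topology M" f']
        by (auto simp: topspace_max_topology)
      then have "f' y \<subseteq> car" by (simp add: mv_max_ideals_def mv_ideal_def)
      moreover have "a \<in> f' y \<longleftrightarrow> p a y = 0" if "a \<in> car" for a
        using astar_hom(2)[OF m that] f' that by auto
      ultimately show "f' y = f y" by (auto simp: f_def)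
    qed
  qed
next
  assume "\<exists>!f. continuous_map euclidean (max_topology M) f \<and> (\<forall>a \<in> car. p a = (\<lambda>y. astar M a (f y)))"
  then obtain f where f: "continuous_map euclidean (max_topology M) f"
    and eq: "\<And>a. a \<in> car \<Longrightarrow> p a = (\<lambda>y. astar M a (f y))" by blast
  have "mv_hom M unit_mv (\<lambda>a. p a y)" for y
  proof -
    have "f y \<in> mv_max_ideals M"
      using continuous_map_image_subset_topspace[OF f] by (auto simp: topspace_max_topology)
    then show ?thesis using astar_hom(1)[of "f y"] by (simp add: mv_hom_def eq)
  qed
  then show "mv_hom M CY p" using PMC_hom_iff[OF p] by blast
qed

text \<open>Gives nonemptiness of the extreme set: the homomorphism at one maximal ideal, taken
  constant in \<open>y\<close>.\<close>

lemma constant_hom_PMC: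
  assumes m: "m \<in> mv_max_ideals M"
  obtains p :: "'a \<Rightarrow> 'y::topological_space \<Rightarrow> real" where "p \<in> PMC M" "mv_hom M CY p"
proof -
  note h = astar_hom(1)[OF m]
  define p :: "'a \<Rightarrow> 'y \<Rightarrow> real" where "p a = (\<lambda>y. if a \<in> car then astar M a m else 0)" for a
  have hp: "mv_hom M unit_mv (\<lambda>a. p a y)" for y using h by (simp add: mv_hom_def p_def)
  have "p \<in> PMC M" by (rule PMC_I) (use hom_is_state[OF hp] in \<open>auto simp: p_def\<close>)
  then show thesis using that[of p] hp PMC_hom_iff by blast
qed

end

theorem theorem4p3:
  fixes M :: "'a mv"
  assumes "mv_algebra M"
    and "mv_semisimple M"
    and "mv_zero M \<noteq> mv_one M"
    and "compact (UNIV :: 'y::t2_space set)"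
  shows "ext2 (PMC M :: ('a \<Rightarrow> 'y \<Rightarrow> real) set) \<noteq> {}
    \<and> (\<forall>p \<in> (PMC M :: ('a \<Rightarrow> 'y \<Rightarrow> real) set).
         ((p \<in> ext2 (PMC M)) = (dual p \<in> ext2 (PMC' M)))
       \<and> ((dual p \<in> ext2 (PMC' M)) = mv_hom M CY p)
       \<and> (mv_hom M CY p = (\<forall>y. dual p y \<in> ext1 (states M)))
       \<and> ((\<forall>y. dual p y \<in> ext1 (states M)) =
          (\<exists>!f. continuous_map euclidean (max_topology M) f \<and>
                (\<forall>a \<in> mv_car M. p a = (\<lambda>y. astar M a (f y))))))"
proof -
  interpret mv_alg M by unfold_locales fact
  have hom_ext: "mv_hom M CY p \<longleftrightarrow> p \<in> ext2 (PMC M)" "mv_hom M CY p \<longleftrightarrow> (\<forall>y. dual p y \<in> ext1 (states M))"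
    if "p \<in> PMC M" for p :: "'a \<Rightarrow> 'y \<Rightarrow> real"
    using that extreme_imp_hom[of p] hom_imp_extreme_state[of p] extreme_states_imp_extreme[of p] by blast+
  \<comment> \<open>Without maximal ideals the intersection would be the whole carrier, and
    semisimplicity would give \<open>\<zero> = \<one>\<close>.\<close>
  have "mv_max_ideals M \<noteq> {}"
    using assms(2,3) one_closed unfolding mv_semisimple_def by fastforce
  then obtain p :: "'a \<Rightarrow> 'y \<Rightarrow> real" where "p \<in> PMC M" "mv_hom M CY p"
    using constant_hom_PMC by blast
  then have ne: "ext2 (PMC M :: ('a \<Rightarrow> 'y \<Rightarrow> real) set) \<noteq> {}" using hom_ext(1) by blast
  have eq: "((p \<in> ext2 (PMC M)) = (dual p \<in> ext2 (PMC' M)))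
       \<and> ((dual p \<in> ext2 (PMC' M)) = mv_hom M CY p)
       \<and> (mv_hom M CY p = (\<forall>y. dual p y \<in> ext1 (states M)))
       \<and> ((\<forall>y. dual p y \<in> ext1 (states M)) =
          (\<exists>!f. continuous_map euclidean (max_topology M) f \<and>
                (\<forall>a \<in> mv_car M. p a = (\<lambda>y. astar M a (f y)))))"
    if p: "p \<in> PMC M" for p :: "'a \<Rightarrow> 'y \<Rightarrow> real"
    by (simp only: extreme_iff_dual_extreme[of p, symmetric] hom_ext[OF p, symmetric]
        hom_iff_unique_continuous[OF p, symmetric])
  show ?thesis by (rule conjI[OF ne ballI]) (rule eq)
qed

end
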